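(* Let $k,m$ be positive integers with $k\equiv0\pmod4$, and let $R_0=R(4m\,\kappa(k,m))$. Then the linear map $$\mathcal D:J^{Spez}_{k,m}(\mathcal O_K)\longrightarrow M_k\oplus\bigoplus_{1\le\nu\le R_0}S_{k+2\nu},\qquad \mathcal D(\phi)=\bigl(D_\nu\phi\bigr)_{0\le\nu\le R_0},$$ is injective.
   Context: Notation: $\mathcal H$ is the upper half plane, $e(x)=e^{2\pi i x}$, $K=\mathbb Q(i)$, $\mathcal O_K=\mathbb Z[i]$, $\mathcal O_K^\times=\{\pm1,\pm i\}$, $N(x)=x\bar x$, $\mathcal O_K^\sharp=\frac i2\mathcal O_K$. For integers $k,m$, $\epsilon\in\mathcal O_K^\times$, $M=\begin{pmatrix}a&b\\c&d\end{pmatrix}\in SL(2,\mathbb Z)$ and $\phi$ a function on $\mathcal H\times\mathbb C^2$: $(\phi|_{k,m}\epsilon M)(\tau,z_1,z_2)=\epsilon^{-k}(c\tau+d)^{-k}e^{-2\pi i m c z_1z_2/(c\tau+d)}\phi\bigl(M\tau,\tfrac{\epsilon z_1}{c\tau+d},\tfrac{\bar\epsilon z_2}{c\tau+d}\bigr)$, $M\tau=\frac{a\tau+b}{c\tau+d}$; for $\lambda,\mu\in\mathcal O_K$, $(\phi|_m[\lambda,\mu])(\tau,z_1,z_2)=e^{2\pi i m(N(\lambda)\tau+\bar\lambda z_1+\lambda z_2)}\phi(\tau,z_1+\lambda\tau+\mu,z_2+\bar\lambda\tau+\bar\mu)$. For positive integers $k,m$, $J_{k,m}(\mathcal O_K)$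 is the space of holomorphic $\phi:\mathcal H\times\mathbb C^2\to\mathbb C$ with $\phi|_{k,m}\epsilon M=\phi$ for all $\epsilon\in\mathcal O_K^\times$, $M\in SL(2,\mathbb Z)$, $\phi|_m[\lambda,\mu]=\phi$ for all $\lambda,\mu\in\mathcal O_K$, and with a Fourier expansion $\phi=\sum_{n\ge0}\sum_{r\in\mathcal O_K^\sharp,\ nm\ge N(r)}c_\phi(n,r)\,e(n\tau+rz_1+\bar rz_2)$. $J^{Spez}_{k,m}(\mathcal O_K)$ is the subspace of $\phi$ whose $c_\phi(n,r)$ depends only on $nm-N(r)$. Write $\phi=\sum_{\alpha,\beta\ge0}\chi_{\alpha,\beta}(\tau)z_1^\alpha z_2^\beta$ and $\phi_0=\sum_{\nu\ge0}\chi_{\nu,\nu}(\tau)(z_1z_2)^\nu$. Let $L_{k,m}=8\pi i m\partial_\tau-\frac{2k-2}{z_1}\partial_{z_2}-\frac{2k-2}{z_2}\partial_{z_1}-4\partial_{z_1}\partial_{z_2}$, $\tilde D_\nu=L_{k+2\nu-2,m}\circ\cdots\circ L_{k,m}$ ($\tilde D_0=\mathrm{id}$), $D_\nu\phi(\tau)=(\tilde D_\nu\phi_0)(\tau,0,0)$; $D_0\phi\in M_k$ and $D_\nu\phi\in S_{k+2\nu}$ for $\nu\ge1$, where $M_w$, $S_w$ are modular forms and cusp forms of weight $w$ for $SL(2,\mathbb Z)$. $\kappa(k,m)=\bigl[\frac{4m^2(k-1)}{3}\prod_{p\mid4m}(1-p^{-2})+\frac m2\bigr]$ (product over primes, $[\cdot]$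 integer part). $r(d)$ is the number of $(x,y)\in\mathbb Z^2$ with $x^2+y^2=d$, and for $4m\mid l$, $R(l)=\sum_{0\le n\le l/(4m)}\sum_{0\le d\le4mn}r(d)$. *)

theory Defs
  imports "HOL-Analysis.Analysis" "HOL-Computational_Algebra.Primes"
begin

definition e :: "complex \<Rightarrow> complex" where
  "e x = exp (2 * of_real pi * \<i> * x)"

definition uhp :: "complex set" where
  "uhp = {\<tau>. Im \<tau> > 0}"

definition gauss_ints :: "complex set" where
  "gauss_ints = {of_int a + \<i> * of_int b | a b. True}"

definition gauss_units :: "complex set" where
  "gauss_units = {1, -1, \<i>, -\<i>}"

(* inverse different O_K^# = (i/2) O_K *)
definition gauss_dual :: "complex set" where
  "gauss_dual = {(\<i> / 2) * x | x. x \<in> gauss_ints}"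

definition normK :: "complex \<Rightarrow> real" where
  "normK x = Re (x * cnj x)"

definition holo_HC2 :: "(complex \<Rightarrow> complex \<Rightarrow> complex \<Rightarrow> complex) \<Rightarrow> bool" where
  "holo_HC2 \<phi> \<longleftrightarrow>
     continuous_on (uhp \<times> UNIV \<times> UNIV) (\<lambda>(\<tau>, z1, z2). \<phi> \<tau> z1 z2) \<and>
     (\<forall>z1 z2. (\<lambda>\<tau>. \<phi> \<tau> z1 z2) holomorphic_on uhp) \<and>
     (\<forall>\<tau>\<in>uhp. \<forall>z2. (\<lambda>z1. \<phi> \<tau> z1 z2) holomorphic_on UNIV) \<and>
     (\<forall>\<tau>\<in>uhp. \<forall>z1. (\<lambda>z2. \<phi> \<tau> z1 z2) holomorphic_on UNIV)"

definition fourier_index :: "nat \<Rightarrow> (nat \<times> complex) set" where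
  "fourier_index m = {(n, r). r \<in> gauss_dual \<and> normK r \<le> real n * real m}"

definition JK :: "nat \<Rightarrow> nat \<Rightarrow> (complex \<Rightarrow> complex \<Rightarrow> complex \<Rightarrow> complex) set" where
  "JK k m = {\<phi>. holo_HC2 \<phi> \<and>
     (\<comment> \<open>phi |_{k,m} eps M = phi\<close>
      \<forall>\<epsilon>\<in>gauss_units. \<forall>a b c d :: int. a * d - b * c = 1 \<longrightarrow>
        (\<forall>\<tau>\<in>uhp. \<forall>z1 z2.
          inverse (\<epsilon> ^ k) * inverse ((of_int c * \<tau> + of_int d) ^ k)
          * e (- of_nat m * of_int c * z1 * z2 / (of_int c * \<tau> + of_int d))
          * \<phi> ((of_int a * \<tau> + of_int b) / (of_int c * \<tau> + of_int d))
               (\<epsilon> * z1 / (of_int c * \<tau> + of_int d))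
               (cnj \<epsilon> * z2 / (of_int c * \<tau> + of_int d))
          = \<phi> \<tau> z1 z2)) \<and>
     (\<comment> \<open>phi |_m [lambda, mu] = phi\<close>
      \<forall>lam\<in>gauss_ints. \<forall>\<mu>\<in>gauss_ints. \<forall>\<tau>\<in>uhp. \<forall>z1 z2.
        e (of_nat m * (of_real (normK lam) * \<tau> + cnj lam * z1 + lam * z2))
        * \<phi> \<tau> (z1 + lam * \<tau> + \<mu>) (z2 + cnj lam * \<tau> + cnj \<mu>)
        = \<phi> \<tau> z1 z2) \<and>
     (\<comment> \<open>Fourier expansion\<close>
      \<exists>c :: nat \<times> complex \<Rightarrow> complex. \<forall>\<tau>\<in>uhp. \<forall>z1 z2.
        ((\<lambda>(n, r). c (n, r) * e (of_nat n * \<tau> + r * z1 + cnj r * z2))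
           has_sum \<phi> \<tau> z1 z2) (fourier_index m))}"

definition JSpez :: "nat \<Rightarrow> nat \<Rightarrow> (complex \<Rightarrow> complex \<Rightarrow> complex \<Rightarrow> complex) set" where
  "JSpez k m = {\<phi>. \<phi> \<in> JK k m \<and>
     (\<exists>c :: nat \<times> complex \<Rightarrow> complex.
        (\<forall>\<tau>\<in>uhp. \<forall>z1 z2.
          ((\<lambda>(n, r). c (n, r) * e (of_nat n * \<tau> + r * z1 + cnj r * z2))
             has_sum \<phi> \<tau> z1 z2) (fourier_index m)) \<and>
        (\<forall>n r n' r'. (n, r) \<in> fourier_index m \<longrightarrow> (n', r') \<in> fourier_index m \<longrightarrow>
           real n * real m - normK r = real n' * real m - normK r' \<longrightarrow>
           c (n, r) = c (n', r')))}"

definition pd_tau :: "(complex \<Rightarrow> complex \<Rightarrow> complex \<Rightarrow> complex) \<Rightarrow> complex \<Rightarrow> complex \<Rightarrow> complex \<Rightarrow> complex" where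
  "pd_tau f = (\<lambda>\<tau> z1 z2. deriv (\<lambda>t. f t z1 z2) \<tau>)"
definition pd_z1 :: "(complex \<Rightarrow> complex \<Rightarrow> complex \<Rightarrow> complex) \<Rightarrow> complex \<Rightarrow> complex \<Rightarrow> complex \<Rightarrow> complex" where
  "pd_z1 f = (\<lambda>\<tau> z1 z2. deriv (\<lambda>w. f \<tau> w z2) z1)"
definition pd_z2 :: "(complex \<Rightarrow> complex \<Rightarrow> complex \<Rightarrow> complex) \<Rightarrow> complex \<Rightarrow> complex \<Rightarrow> complex \<Rightarrow> complex" where
  "pd_z2 f = (\<lambda>\<tau> z1 z2. deriv (\<lambda>w. f \<tau> z1 w) z2)"

definition chi :: "(complex \<Rightarrow> complex \<Rightarrow> complex \<Rightarrow> complex) \<Rightarrow> nat \<Rightarrow> nat \<Rightarrow> complex \<Rightarrow> complex" where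
  "chi \<phi> \<alpha> \<beta> \<tau> = ((pd_z1 ^^ \<alpha>) ((pd_z2 ^^ \<beta>) \<phi>)) \<tau> 0 0 / (fact \<alpha> * fact \<beta>)"

definition phi0 :: "(complex \<Rightarrow> complex \<Rightarrow> complex \<Rightarrow> complex) \<Rightarrow> complex \<Rightarrow> complex \<Rightarrow> complex \<Rightarrow> complex" where
  "phi0 \<phi> = (\<lambda>\<tau> z1 z2. \<Sum>\<nu>. chi \<phi> \<nu> \<nu> \<tau> * (z1 * z2) ^ \<nu>)"

definition Lop :: "nat \<Rightarrow> nat \<Rightarrow> (complex \<Rightarrow> complex \<Rightarrow> complex \<Rightarrow> complex) \<Rightarrow> complex \<Rightarrow> complex \<Rightarrow> complex \<Rightarrow> complex" where
  "Lop k m f = (\<lambda>\<tau> z1 z2.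
      8 * of_real pi * \<i> * of_nat m * pd_tau f \<tau> z1 z2
      - (2 * of_nat k - 2) / z1 * pd_z2 f \<tau> z1 z2
      - (2 * of_nat k - 2) / z2 * pd_z1 f \<tau> z1 z2
      - 4 * pd_z1 (pd_z2 f) \<tau> z1 z2)"

fun Dtilde :: "nat \<Rightarrow> nat \<Rightarrow> nat \<Rightarrow> (complex \<Rightarrow> complex \<Rightarrow> complex \<Rightarrow> complex) \<Rightarrow> complex \<Rightarrow> complex \<Rightarrow> complex \<Rightarrow> complex" where
  "Dtilde k m 0 f = f"
| "Dtilde k m (Suc \<nu>) f = Lop (k + 2 * \<nu>) m (Dtilde k m \<nu> f)"

(* D_nu phi (tau) = (tilde D_nu phi_0)(tau,0,0), the value at z=0 understood as the
   (holomorphic) continuous extension from z1 z2 <> 0, where the formula for L is defined *)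
definition Dop :: "nat \<Rightarrow> nat \<Rightarrow> nat \<Rightarrow> (complex \<Rightarrow> complex \<Rightarrow> complex \<Rightarrow> complex) \<Rightarrow> complex \<Rightarrow> complex" where
  "Dop k m \<nu> \<phi> \<tau> =
     Lim (at (0, 0) within {p :: complex \<times> complex. fst p \<noteq> 0 \<and> snd p \<noteq> 0})
         (\<lambda>(z1, z2). Dtilde k m \<nu> (phi0 \<phi>) \<tau> z1 z2)"

definition kappa :: "nat \<Rightarrow> nat \<Rightarrow> nat" where
  "kappa k m = nat \<lfloor>4 * real m ^ 2 * (real k - 1) / 3
        * (\<Prod>p\<in>prime_factors (4 * m). (1 - 1 / real p ^ 2)) + real m / 2\<rfloor>"

definition rsq :: "nat \<Rightarrow> nat" where
  "rsq d = card {p :: int \<times> int. fst p ^ 2 + snd p ^ 2 = int d}"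

(* R(l) for 4m | l *)
definition Rfun :: "nat \<Rightarrow> nat \<Rightarrow> nat" where
  "Rfun m l = (\<Sum>n\<in>{0..l div (4 * m)}. \<Sum>d\<in>{0..4 * m * n}. rsq d)"

end

(* Put q = e \<tau>. Expanding in q and s = z1 z2 turns the operators L into a triangular recursion, so that
   equality of D_\<nu> for \<nu> \<le> R_0 gives equality of the power sums of N(r) weighted by c(n,r), up to exponent R_0.
   For special forms c(n,r) depends only on N(r) once n is fixed, and 4 N(r) takes at most 4nm + 1 values, so
   polynomial interpolation gives equality of all c(n,r) with 4nm \<le> R_0, in particular with n \<le> \<kappa>(k,m).

   It remains to see that a form whose coefficients c(n,r) vanish for n \<le> \<kappa>(k,m) is zero. This is Siegel's argument
   applied directly to the Jacobi form, without theta decomposition: with y = Im \<tau> the function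
   W = y^(k/2) exp(- \<pi> m |z1 - cnj z2|^2 / (2y)) |\<phi>| is invariant under the Jacobi group. On the slices
   z1 = l \<tau> + u, z2 = cnj l \<tau> + cnj u it is y^(k/2) times the absolute value of a series in exp(2 \<pi> i E \<tau>) with
   E = n + 2 Re (r l) + m |l|^2, and after a lattice translation |l|^2 \<le> 1/2, so that every E is at least 3k/16.
   By the maximum principle, W \<le> B everywhere implies W \<le> \<rho> B for y \<ge> 3/4 with some \<rho> < 1, hence everywhere
   by reduction theory; iterating gives W = 0. *)
theory Submission
  imports Defs "HOL-Complex_Analysis.Complex_Analysis"
begin

section \<open>Double power series\<close>

text \<open>Where the numbers come from. A term exp(2 \<pi> i E \<tau>) with E at least 3k/16 decays
  at least like exp(- 3 \<pi> k y / 8), against the growth y^(k/2). Going from height y/2 up to y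
  therefore costs at most the factor (sqrt 2 exp(- 3 \<pi> y / 16))^k, which is below 1 once y
  exceeds 8 log 2 / (3 \<pi>), about 0.59. Reduction theory can move every point up to height sqrt 3
  / 2, about 0.87. The threshold 3/4 lies between the two; being strictly below sqrt 3 / 2, it makes
  each inversion gain a fixed factor, so that no fundamental domain is needed. The rearrangements of
  series all rest on one fact: c(n,r) exp(- 2 \<pi> n y) exp(2 \<pi> t |r|) is absolutely summable
  for every t >= 0. It is read off from the Fourier expansion at suitable complex arguments, so no
  growth estimate for the coefficients is required.\<close>

definition double_series :: "real \<Rightarrow> (nat \<Rightarrow> nat \<Rightarrow> complex) \<Rightarrow> (complex \<Rightarrow> complex \<Rightarrow> complex) \<Rightarrow> bool" where
  "double_series R a f \<longleftrightarrow>
     (\<forall>x y. norm x < R \<longrightarrow> ((\<lambda>(i, j). a i j * x ^ i * y ^ j) has_sum f x y) UNIV)"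

definition shift_left :: "(nat \<Rightarrow> nat \<Rightarrow> complex) \<Rightarrow> nat \<Rightarrow> nat \<Rightarrow> complex" where
  "shift_left a i j = of_nat (Suc i) * a (Suc i) j"

definition shift_right :: "(nat \<Rightarrow> nat \<Rightarrow> complex) \<Rightarrow> nat \<Rightarrow> nat \<Rightarrow> complex" where
  "shift_right a i j = of_nat (Suc j) * a i (Suc j)"

definition deriv_left :: "(complex \<Rightarrow> complex \<Rightarrow> complex) \<Rightarrow> complex \<Rightarrow> complex \<Rightarrow> complex" where
  "deriv_left f x y = deriv (\<lambda>w. f w y) x"

definition deriv_right :: "(complex \<Rightarrow> complex \<Rightarrow> complex) \<Rightarrow> complex \<Rightarrow> complex \<Rightarrow> complex" where
  "deriv_right f x y = deriv (\<lambda>w. f x w) y"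

text \<open>Each of the n + 1 copies of t^n is at most one of the terms t^0, ..., t^n of the
  geometric series.\<close>

lemma Suc_mult_power_le:
  fixes t :: real
  assumes "0 \<le> t" "t < 1"
  shows "real (Suc n) * t ^ n \<le> 1 / (1 - t)"
proof -
  have "real (Suc n) * t ^ n = (\<Sum>i\<le>n. t ^ n)"
    by simp
  also have "\<dots> \<le> (\<Sum>i\<le>n. t ^ i)"
    using assms by (intro sum_mono power_decreasing) auto
  also have "\<dots> \<le> (\<Sum>i. t ^ i)"
    using assms by (intro sum_le_suminf summable_geometric) auto
  also have "\<dots> = 1 / (1 - t)"
    using assms by (intro suminf_geometric) auto
  finally show ?thesis .
qed

text \<open>For fixed y the inner sums turn f into a single power series in w, which may be
  differentiated termwise. It remains to unfold the result into a double sum: the differentiated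
  family is absolutely summable by comparison with the original one at a slightly larger radius
  \<rho>, and its sum by rows is the termwise derivative.\<close>

lemma has_sum_row_derivative:
  fixes a :: "nat \<Rightarrow> nat \<Rightarrow> complex"
  assumes sum: "\<And>w. norm w < R \<Longrightarrow> ((\<lambda>(i, j). a i j * w ^ i * y ^ j) has_sum f w) UNIV"
    and x: "norm x < R"
  obtains D where "(f has_field_derivative D) (at x)"
    and "((\<lambda>(i, j). shift_left a i j * x ^ i * y ^ j) has_sum D) UNIV"
proof -
  obtain \<rho> where \<rho>: "norm x < \<rho>" "\<rho> < R"
    using dense x by blast
  have \<rho>0: "\<rho> > 0"
    using \<rho>(1) norm_ge_zero[of x] by linarith
  have abs: "(\<lambda>p. norm (case p of (i, j) \<Rightarrow> a i j * of_real \<rho> ^ i * y ^ j)) summable_on UNIV"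
    using sum[of "of_real \<rho>"] \<rho> \<rho>0 has_sum_imp_summable
    by (subst summable_on_iff_abs_summable_on_complex[symmetric]) force
  have row: "(\<lambda>j. a i j * y ^ j) summable_on UNIV" for i
  proof -
    have "(\<lambda>p. case p of (i, j) \<Rightarrow> a i j * of_real \<rho> ^ i * y ^ j) summable_on Sigma UNIV (\<lambda>_. UNIV)"
      using sum[of "of_real \<rho>"] \<rho> \<rho>0 has_sum_imp_summable by force
    from summable_on_SigmaD1[OF this, of i]
    have "(\<lambda>j. a i j * of_real \<rho> ^ i * y ^ j) summable_on UNIV"
      by simp
    from summable_on_cmult_right[OF this, of "inverse (of_real \<rho> ^ i)"] show ?thesis
      using \<rho>0 by (simp add: field_simps)
  qed
  define b where "b i = (\<Sum>\<^sub>\<infinity>j. a i j * y ^ j)" for i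
  have b: "((\<lambda>j. a i j * y ^ j) has_sum b i) UNIV" for i
    unfolding b_def using row by (rule has_sum_infsum)
  have fsums: "(\<lambda>i. b i * w ^ i) sums f w" if "norm w < R" for w
  proof (rule has_sum_imp_sums, rule has_sum_SigmaD)
    show "((\<lambda>(i, j). a i j * w ^ i * y ^ j) has_sum f w) (Sigma UNIV (\<lambda>_. UNIV))"
      using sum[OF that] by simp
    show "((\<lambda>j. case (i, j) of (i, j) \<Rightarrow> a i j * w ^ i * y ^ j) has_sum b i * w ^ i) UNIV" for i
      using has_sum_cmult_left[OF b[of i], of "w ^ i"] by (simp add: mult_ac)
  qed
  have "f field_differentiable at x"
  proof -
    have "summable (\<lambda>n. b n * of_real \<rho> ^ n)"
      using fsums[of "of_real \<rho>"] \<rho> \<rho>0 by (auto simp: sums_iff)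
    then have "((\<lambda>w. \<Sum>n. b n * w ^ n) has_field_derivative (\<Sum>n. diffs b n * x ^ n)) (at x)"
      by (rule termdiffs_strong) (use \<rho> \<rho>0 in auto)
    moreover have "\<forall>\<^sub>F w in nhds x. (\<Sum>n. b n * w ^ n) = f w"
      using x fsums by (intro eventually_nhds_in_open[of "ball 0 R", THEN eventually_mono]) (auto simp: sums_iff)
    ultimately have "(f has_field_derivative (\<Sum>n. diffs b n * x ^ n)) (at x)"
      using DERIV_cong_ev[of x x "\<lambda>w. \<Sum>n. b n * w ^ n" f] by simp
    then show ?thesis
      by (auto simp: field_differentiable_def)
  qed
  then obtain D where D: "(f has_field_derivative D) (at x)"
    by (auto simp: field_differentiable_def)
  have Dsums: "(\<lambda>n. diffs b n * x ^ n) sums D"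
    using fsums D x by (rule termdiffs_sums_strong)
  have "(\<lambda>(i, j). shift_left a i j * x ^ i * y ^ j) summable_on UNIV"
  proof -
    define t where "t = norm x / \<rho>"
    have t: "0 \<le> t" "t < 1"
      using \<rho> \<rho>0 by (auto simp: t_def)
    have "(\<lambda>(i, j). norm (a (Suc i) j * of_real \<rho> ^ Suc i * y ^ j)) summable_on UNIV"
    proof -
      have inj: "inj (\<lambda>(i, j :: nat). (Suc i, j))"
        by (auto simp: inj_on_def)
      have "(\<lambda>p. norm (case p of (i, j) \<Rightarrow> a i j * of_real \<rho> ^ i * y ^ j)) summable_on range (\<lambda>(i, j). (Suc i, j))"
        using abs by (rule summable_on_subset) auto
      then show ?thesis
        by (subst (asm) summable_on_reindex[OF inj]) (auto simp: o_def case_prod_unfold)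
    qed
    from summable_on_cmult_right[OF this, of "1 / (1 - t) / \<rho>"]
    have "(\<lambda>p. norm (case p of (i, j) \<Rightarrow> shift_left a i j * x ^ i * y ^ j)) summable_on UNIV"
    proof (rule Infinite_Sum.abs_summable_on_comparison_test', goal_cases)
      case (1 p)
      obtain i j where p: "p = (i, j)" by fastforce
      have "norm (shift_left a i j * x ^ i * y ^ j)
          = (real (Suc i) * t ^ i) * (norm (a (Suc i) j) * \<rho> ^ i * norm y ^ j)"
        using \<rho>0 by (simp add: shift_left_def norm_mult norm_power t_def power_divide del: of_nat_Suc)
      also have "\<dots> \<le> 1 / (1 - t) * (norm (a (Suc i) j) * \<rho> ^ i * norm y ^ j)"
        using \<rho>0 by (intro mult_right_mono Suc_mult_power_le t) auto
      also have "\<dots> = 1 / (1 - t) / \<rho> * norm (a (Suc i) j * of_real \<rho> ^ Suc i * y ^ j)"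
        using \<rho>0 t by (simp add: norm_mult norm_power)
      finally show ?case
        by (simp only: p prod.case)
    qed
    then show ?thesis
      using summable_on_iff_abs_summable_on_complex by blast
  qed
  then have S: "((\<lambda>(i, j). shift_left a i j * x ^ i * y ^ j) has_sum
      infsum (\<lambda>(i, j). shift_left a i j * x ^ i * y ^ j) UNIV) UNIV" (is "(_ has_sum ?S) _")
    by (rule has_sum_infsum)
  have "(\<lambda>i. diffs b i * x ^ i) sums ?S"
  proof (rule has_sum_imp_sums, rule has_sum_SigmaD)
    show "((\<lambda>(i, j). shift_left a i j * x ^ i * y ^ j) has_sum ?S) (Sigma UNIV (\<lambda>_. UNIV))"
      using S by simp
    show "((\<lambda>j. case (i, j) of (i, j) \<Rightarrow> shift_left a i j * x ^ i * y ^ j) has_sum diffs b i * x ^ i) UNIV" for i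
      using has_sum_cmult_left[OF b[of "Suc i"], of "of_nat (Suc i) * x ^ i"]
      by (simp add: mult_ac shift_left_def diffs_def)
  qed
  then have "?S = D"
    using Dsums by (rule sums_unique2)
  then show thesis
    by (intro that[of D] D) (use S in simp)
qed

lemma double_series_has_derivative_left:
  assumes "double_series R a f" "norm x < R"
  shows "((\<lambda>w. f w y) has_field_derivative deriv_left f x y) (at x)"
    and "((\<lambda>(i, j). shift_left a i j * x ^ i * y ^ j) has_sum deriv_left f x y) UNIV"
proof -
  obtain D where D: "((\<lambda>w. f w y) has_field_derivative D) (at x)"
    "((\<lambda>(i, j). shift_left a i j * x ^ i * y ^ j) has_sum D) UNIV"
    using has_sum_row_derivative[of R a y "\<lambda>w. f w y" x] assms
    by (auto simp: double_series_def)
  have "deriv_left f x y = D"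
    unfolding deriv_left_def using D(1) by (rule DERIV_imp_deriv)
  then show "((\<lambda>w. f w y) has_field_derivative deriv_left f x y) (at x)"
    and "((\<lambda>(i, j). shift_left a i j * x ^ i * y ^ j) has_sum deriv_left f x y) UNIV"
    using D by auto
qed

lemma double_series_has_derivative_right:
  assumes "double_series R a f" "norm x < R"
  shows "((\<lambda>w. f x w) has_field_derivative deriv_right f x y) (at y)"
    and "((\<lambda>(i, j). shift_right a i j * x ^ i * y ^ j) has_sum deriv_right f x y) UNIV"
proof -
  have swap: "((\<lambda>(i, j). a j i * w ^ i * x ^ j) has_sum f x w) UNIV" for w
  proof -
    have "((\<lambda>(i, j). a i j * x ^ i * w ^ j) has_sum f x w) (UNIV \<times> UNIV)"
      using assms by (simp add: double_series_def)
    then show ?thesis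
      by (subst (asm) has_sum_swap) (simp add: mult_ac)
  qed
  \<comment> \<open>Only the first variable is confined to a disc, so any radius beyond
    \<open>norm y\<close> may be used here.\<close>
  obtain D where D: "((\<lambda>w. f x w) has_field_derivative D) (at y)"
    "((\<lambda>(i, j). shift_left (\<lambda>i j. a j i) i j * y ^ i * x ^ j) has_sum D) UNIV"
    by (rule has_sum_row_derivative[of "norm y + 1" "\<lambda>i j. a j i" x "\<lambda>w. f x w" y])
       (use swap in auto)
  have "((\<lambda>(i, j). shift_left (\<lambda>i j. a j i) i j * y ^ i * x ^ j) has_sum D) (UNIV \<times> UNIV)"
    using D(2) by simp
  then have "((\<lambda>(i, j). shift_right a i j * x ^ i * y ^ j) has_sum D) UNIV"
    by (subst (asm) has_sum_swap) (simp add: shift_left_def shift_right_def mult_ac)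
  moreover have "deriv_right f x y = D"
    unfolding deriv_right_def using D(1) by (rule DERIV_imp_deriv)
  ultimately show "((\<lambda>w. f x w) has_field_derivative deriv_right f x y) (at y)"
    and "((\<lambda>(i, j). shift_right a i j * x ^ i * y ^ j) has_sum deriv_right f x y) UNIV"
    using D by auto
qed

lemma double_series_deriv_left:
  "double_series R a f \<Longrightarrow> double_series R (shift_left a) (deriv_left f)"
  unfolding double_series_def[of R "shift_left a"]
  using double_series_has_derivative_left(2) by blast

lemma double_series_deriv_right:
  "double_series R a f \<Longrightarrow> double_series R (shift_right a) (deriv_right f)"
  unfolding double_series_def[of R "shift_right a"]
  using double_series_has_derivative_right(2) by blast

lemma double_series_add:
  assumes "double_series R a f" "double_series R b g"
  shows "double_series R (\<lambda>i j. a i j + b i j) (\<lambda>x y. f x y + g x y)"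
  unfolding double_series_def
proof (intro allI impI)
  fix x y :: complex assume "norm x < R"
  then have "((\<lambda>p. (case p of (i, j) \<Rightarrow> a i j * x ^ i * y ^ j) + (case p of (i, j) \<Rightarrow> b i j * x ^ i * y ^ j))
      has_sum f x y + g x y) UNIV"
    using assms by (intro has_sum_add) (auto simp: double_series_def)
  then show "((\<lambda>(i, j). (a i j + b i j) * x ^ i * y ^ j) has_sum f x y + g x y) UNIV"
    by (simp add: case_prod_unfold algebra_simps)
qed

lemma double_series_scale:
  assumes "double_series R a f"
  shows "double_series R (\<lambda>i j. c * a i j) (\<lambda>x y. c * f x y)"
  unfolding double_series_def
proof (intro allI impI)
  fix x y :: complex assume "norm x < R"
  then have "((\<lambda>p. c * (case p of (i, j) \<Rightarrow> a i j * x ^ i * y ^ j)) has_sum c * f x y) UNIV"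
    using assms by (intro has_sum_cmult_right) (auto simp: double_series_def)
  then show "((\<lambda>(i, j). c * a i j * x ^ i * y ^ j) has_sum c * f x y) UNIV"
    by (simp add: case_prod_unfold algebra_simps)
qed

lemma double_series_mult_left:
  assumes "double_series R a f"
  shows "double_series R (\<lambda>i j. case i of 0 \<Rightarrow> 0 | Suc i' \<Rightarrow> a i' j) (\<lambda>x y. x * f x y)"
  unfolding double_series_def
proof (intro allI impI)
  fix x y :: complex assume x: "norm x < R"
  let ?h = "\<lambda>(i, j). (case i of 0 \<Rightarrow> 0 | Suc i' \<Rightarrow> a i' j) * x ^ i * y ^ j"
  have inj: "inj (\<lambda>(i, j :: nat). (Suc i, j))"
    by (auto simp: inj_on_def)
  have "((\<lambda>p. x * (case p of (i, j) \<Rightarrow> a i j * x ^ i * y ^ j)) has_sum x * f x y) UNIV"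
    using assms x by (intro has_sum_cmult_right) (auto simp: double_series_def)
  also have "(\<lambda>p. x * (case p of (i, j) \<Rightarrow> a i j * x ^ i * y ^ j)) = ?h \<circ> (\<lambda>(i, j). (Suc i, j))"
    by (auto simp: fun_eq_iff)
  finally have "(?h has_sum x * f x y) (range (\<lambda>(i, j). (Suc i, j)))"
    by (subst has_sum_reindex[OF inj])
  then show "(?h has_sum x * f x y) UNIV"
  proof (rule has_sum_cong_neutral[THEN iffD1, rotated -1], goal_cases)
    case (1 p)
    then show ?case
      by (cases p; cases "fst p") force+
  qed auto
qed

lemma double_series_mult_right:
  assumes "double_series R a f"
  shows "double_series R (\<lambda>i j. case j of 0 \<Rightarrow> 0 | Suc j' \<Rightarrow> a i j') (\<lambda>x y. y * f x y)"
  unfolding double_series_def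
proof (intro allI impI)
  fix x y :: complex assume x: "norm x < R"
  let ?h = "\<lambda>(i, j). (case j of 0 \<Rightarrow> 0 | Suc j' \<Rightarrow> a i j') * x ^ i * y ^ j"
  have inj: "inj (\<lambda>(i :: nat, j). (i, Suc j))"
    by (auto simp: inj_on_def)
  have "((\<lambda>p. y * (case p of (i, j) \<Rightarrow> a i j * x ^ i * y ^ j)) has_sum y * f x y) UNIV"
    using assms x by (intro has_sum_cmult_right) (auto simp: double_series_def)
  also have "(\<lambda>p. y * (case p of (i, j) \<Rightarrow> a i j * x ^ i * y ^ j)) = ?h \<circ> (\<lambda>(i, j). (i, Suc j))"
    by (auto simp: fun_eq_iff)
  finally have "(?h has_sum y * f x y) (range (\<lambda>(i, j). (i, Suc j)))"
    by (subst has_sum_reindex[OF inj])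
  then show "(?h has_sum y * f x y) UNIV"
  proof (rule has_sum_cong_neutral[THEN iffD1, rotated -1], goal_cases)
    case (1 p)
    then show ?case
      by (cases p; cases "snd p") force+
  qed auto
qed

lemma double_series_at_0_right:
  assumes "double_series R a f" "norm x < R"
  shows "(\<lambda>i. a i 0 * x ^ i) sums f x 0"
proof (rule has_sum_imp_sums, rule has_sum_SigmaD)
  show "((\<lambda>(i, j). a i j * x ^ i * 0 ^ j) has_sum f x 0) (Sigma UNIV (\<lambda>_. UNIV))"
    using assms by (simp add: double_series_def)
  show "((\<lambda>j. case (i, j) of (i, j) \<Rightarrow> a i j * x ^ i * 0 ^ j) has_sum a i 0 * x ^ i) UNIV" for i
    using has_sum_finite_neutralI[of "{0 :: nat}" UNIV "\<lambda>j. a i j * x ^ i * 0 ^ j"] by auto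
qed

lemma double_series_at_0:
  assumes "double_series R a f" "R > 0"
  shows "f 0 0 = a 0 0"
  using double_series_at_0_right[OF assms(1), of 0] assms(2) powser_sums_zero[of "\<lambda>i. a i 0"]
  by (auto dest: sums_unique2)

lemma double_series_funpow:
  assumes "double_series R a f"
  shows "double_series R ((shift_left ^^ \<alpha>) ((shift_right ^^ \<beta>) a))
           ((deriv_left ^^ \<alpha>) ((deriv_right ^^ \<beta>) f))"
proof -
  have "double_series R ((shift_right ^^ \<beta>) a) ((deriv_right ^^ \<beta>) f)"
    by (induction \<beta>) (use assms in \<open>auto intro: double_series_deriv_right\<close>)
  then show ?thesis
    by (induction \<alpha>) (auto intro: double_series_deriv_left)
qed

lemma funpow_shift_right: "(shift_right ^^ n) a i j = fact (n + j) / fact j * a i (n + j)"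
proof (induction n arbitrary: j)
  case (Suc n)
  have "(shift_right ^^ Suc n) a i j = of_nat (Suc j) * (fact (n + Suc j) / fact (Suc j) * a i (n + Suc j))"
    by (simp add: shift_right_def Suc.IH)
  also have "\<dots> = fact (Suc n + j) / fact j * a i (Suc n + j)"
    by (simp del: of_nat_Suc)
  finally show ?case .
qed auto

lemma funpow_shift_left: "(shift_left ^^ n) a i j = fact (n + i) / fact i * a (n + i) j"
proof (induction n arbitrary: i)
  case (Suc n)
  have "(shift_left ^^ Suc n) a i j = of_nat (Suc i) * (fact (n + Suc i) / fact (Suc i) * a (n + Suc i) j)"
    by (simp add: shift_left_def Suc.IH)
  also have "\<dots> = fact (Suc n + i) / fact i * a (Suc n + i) j"
    by (simp del: of_nat_Suc)
  finally show ?case .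
qed auto

lemma double_series_mixed_derivative_at_0:
  assumes "double_series R a f" "R > 0"
  shows "(deriv_left ^^ \<alpha>) ((deriv_right ^^ \<beta>) f) 0 0 = fact \<alpha> * fact \<beta> * a \<alpha> \<beta>"
  using double_series_at_0[OF double_series_funpow[OF assms(1)] assms(2)]
  by (simp add: funpow_shift_left funpow_shift_right)

section \<open>Taylor coefficients of a Fourier expansion\<close>

lemma has_sum_exp:
  fixes x :: "'a :: {banach, real_normed_field}"
  shows "((\<lambda>n. x ^ n / fact n) has_sum exp x) UNIV"
proof (rule norm_summable_imp_has_sum)
  show "summable (\<lambda>n. norm (x ^ n / fact n))"
    using summable_norm_exp[of x] by (simp add: divide_inverse norm_mult norm_inverse mult_ac)
  show "(\<lambda>n. x ^ n / fact n) sums exp x"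
    using exp_converges[of x] by (simp add: scaleR_conv_of_real divide_inverse mult_ac)
qed

lemma abs_summable_exp_product:
  fixes x y :: complex
  shows "((\<lambda>(i, j). norm (x ^ i / fact i * (y ^ j / fact j))) has_sum exp (norm x) * exp (norm y)) UNIV"
proof -
  have x: "((\<lambda>n. norm (x ^ n / fact n)) has_sum exp (norm x)) UNIV" for x :: complex
    using has_sum_exp[of "norm x"] by (simp add: norm_divide norm_power)
  have row: "((\<lambda>j. case (i, j) of (i, j) \<Rightarrow> norm (x ^ i / fact i * (y ^ j / fact j)))
      has_sum norm (x ^ i / fact i) * exp (norm y)) UNIV" for i
    using has_sum_cmult_right[OF x[of y], of "norm (x ^ i / fact i)"]
    by (simp only: prod.case norm_mult)
  have col: "((\<lambda>i. norm (x ^ i / fact i) * exp (norm y)) has_sum exp (norm x) * exp (norm y)) UNIV"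
    by (rule has_sum_cmult_left[OF x])
  have "((\<lambda>(i, j). norm (x ^ i / fact i * (y ^ j / fact j))) has_sum exp (norm x) * exp (norm y))
          (Sigma UNIV (\<lambda>_. UNIV))"
    by (rule has_sum_SigmaI[OF row col], rule summable_on_SigmaI[OF row has_sum_imp_summable[OF col]]) auto
  then show ?thesis
    by simp
qed

lemma has_sum_exp_product:
  fixes x y :: complex
  shows "((\<lambda>(i, j). x ^ i / fact i * (y ^ j / fact j)) has_sum exp x * exp y) UNIV"
proof -
  have "(\<lambda>p. norm (case p of (i, j) \<Rightarrow> x ^ i / fact i * (y ^ j / fact j))) summable_on UNIV"
    using has_sum_imp_summable[OF abs_summable_exp_product[of x y]] by (simp add: case_prod_unfold)
  then have summable: "(\<lambda>(i, j). x ^ i / fact i * (y ^ j / fact j)) summable_on (Sigma UNIV (\<lambda>_. UNIV))"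
    by (subst summable_on_iff_abs_summable_on_complex) simp
  have row: "((\<lambda>j. case (i, j) of (i, j) \<Rightarrow> x ^ i / fact i * (y ^ j / fact j))
      has_sum x ^ i / fact i * exp y) UNIV" for i
    using has_sum_cmult_right[OF has_sum_exp[of y], of "x ^ i / fact i"]
    by (simp only: prod.case)
  show ?thesis
    using has_sum_SigmaI[OF row has_sum_cmult_left[OF has_sum_exp] summable] by simp
qed

text \<open>Fubini for unordered sums. It serves to pass from a sum over Fourier indices of
  exponentials to a sum over Taylor exponents; joint summability is the only analytic input.\<close>

lemma has_sum_exchange:
  fixes T :: "'a \<times> 'b \<Rightarrow> complex"
  assumes T: "T summable_on A \<times> B"
    and row: "\<And>p. p \<in> A \<Longrightarrow> ((\<lambda>q. T (p, q)) has_sum u p) B"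
    and u: "(u has_sum S) A"
    and col: "\<And>q. q \<in> B \<Longrightarrow> ((\<lambda>p. T (p, q)) has_sum v q) A"
  shows "(v has_sum S) B"
proof -
  have "(T has_sum S) (A \<times> B)"
    using row u T by (rule has_sum_SigmaI)
  then have "((\<lambda>(q, p). T (p, q)) has_sum S) (B \<times> A)"
    by (subst has_sum_swap[symmetric])
  then show ?thesis
    by (rule has_sum_SigmaD) (use col in auto)
qed

section \<open>The character \<open>e\<close> and the dual lattice\<close>

lemma open_uhp: "open uhp"
  unfolding uhp_def by (rule open_halfspace_Im_gt)

lemma norm_e: "norm (e z) = exp (- 2 * pi * Im z)"
  by (simp add: e_def norm_exp_eq_Re)

lemma e_add: "e (x + y) = e x * e y"
  by (simp add: e_def distrib_left exp_add)

lemma e_of_nat_mult: "e (of_nat n * x) = e x ^ n"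
  unfolding e_def exp_of_nat_mult[symmetric] by (simp add: mult_ac)

lemma normK_eq: "normK r = (norm r)\<^sup>2"
  by (simp add: normK_def complex_mult_cnj cmod_power2)

lemma of_real_normK: "of_real (normK r) = r * cnj r"
  unfolding normK_eq by (rule complex_norm_square)

lemma e_has_field_derivative: "(e has_field_derivative 2 * of_real pi * \<i> * e z) (at z)"
  unfolding e_def[abs_def] by (auto intro!: derivative_eq_intros)

definition dual_ball :: "nat \<Rightarrow> nat \<Rightarrow> complex set" where
  "dual_ball m n = {r \<in> gauss_dual. normK r \<le> real n * real m}"

lemma fourier_index_eq_Sigma: "fourier_index m = Sigma UNIV (dual_ball m)"
  by (auto simp: fourier_index_def dual_ball_def)

text \<open>In half-integral coordinates 4 N(r) is a sum of two integer squares. This gives both the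
  finiteness of the sets \<open>dual_ball\<close> and the integer nodes of the later
  interpolation.\<close>

lemma gauss_dual_cases:
  assumes "r \<in> gauss_dual"
  obtains x y :: int where "r = Complex (of_int x / 2) (of_int y / 2)" "4 * normK r = of_int (x\<^sup>2 + y\<^sup>2)"
proof -
  obtain a b where r: "r = \<i> / 2 * (of_int a + \<i> * of_int b)"
    using assms by (auto simp: gauss_dual_def gauss_ints_def)
  have "r = Complex (of_int (- b) / 2) (of_int a / 2)"
    by (simp add: r complex_eq_iff)
  moreover from this have "4 * normK r = of_int ((- b)\<^sup>2 + a\<^sup>2)"
    unfolding normK_eq cmod_power2 by (simp add: power_divide)
  ultimately show thesis
    by (rule that)
qed

lemma finite_dual_ball: "finite (dual_ball m n)"
proof (rule finite_subset)
  let ?K = "int (4 * n * m)"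
  show "dual_ball m n \<subseteq> (\<lambda>(x, y). Complex (of_int x / 2) (of_int y / 2)) ` ({- ?K..?K} \<times> {- ?K..?K})"
  proof
    fix r assume r: "r \<in> dual_ball m n"
    then obtain x y where xy: "r = Complex (of_int x / 2) (of_int y / 2)" "4 * normK r = of_int (x\<^sup>2 + y\<^sup>2)"
      using gauss_dual_cases by (auto simp: dual_ball_def)
    have "of_int (x\<^sup>2 + y\<^sup>2) \<le> (of_int ?K :: real)"
      using r xy(2) by (simp add: dual_ball_def mult_ac)
    then have "x\<^sup>2 + y\<^sup>2 \<le> ?K"
      by linarith
    moreover have "\<bar>z\<bar> \<le> z\<^sup>2" for z :: int
      using self_le_power[of "\<bar>z\<bar>" 2] by (cases "z = 0") auto
    ultimately have "\<bar>x\<bar> \<le> ?K" "\<bar>y\<bar> \<le> ?K"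
      by (smt (verit) zero_le_power2)+
    then show "r \<in> (\<lambda>(x, y). Complex (of_int x / 2) (of_int y / 2)) ` ({- ?K..?K} \<times> {- ?K..?K})"
      using xy(1) by (intro image_eqI[of _ _ "(x, y)"]) auto
  qed
qed auto

section \<open>From the Fourier expansion to Taylor coefficients in z1, z2\<close>

locale fourier_expansion =
  fixes m :: nat and c :: "nat \<times> complex \<Rightarrow> complex"
    and f :: "complex \<Rightarrow> complex \<Rightarrow> complex \<Rightarrow> complex"
  assumes expansion: "\<tau> \<in> uhp \<Longrightarrow>
    ((\<lambda>(n, r). c (n, r) * e (of_nat n * \<tau> + r * z1 + cnj r * z2)) has_sum f \<tau> z1 z2) (fourier_index m)"
begin

text \<open>The exponential of \<open>\<bar>r\<bar>\<close> is dominated by the characters at four points \<open>(z1, z2)\<close>,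
  one for each choice of signs of the real and imaginary part of \<open>r\<close>.\<close>

lemma summable_exp_norm:
  assumes \<tau>: "\<tau> \<in> uhp" and t: "t \<ge> 0"
  shows "(\<lambda>(n, r). norm (c (n, r)) * exp (- 2 * pi * real n * Im \<tau>) * exp (2 * pi * t * norm r))
           summable_on fourier_index m"
proof -
  let ?g = "\<lambda>\<sigma> \<sigma>' (n, r). norm (c (n, r)) * exp (- 2 * pi * real n * Im \<tau>) *
             exp (2 * pi * t * (\<sigma> * Re r + \<sigma>' * Im r))"
  have g: "?g \<sigma> \<sigma>' summable_on fourier_index m" for \<sigma> \<sigma>' :: real
  proof -
    \<comment> \<open>At z1 = - i \<zeta> and z2 = - i \<open>cnj \<zeta>\<close> the character of r
      has absolute value exp(4 \<pi> Re (r \<zeta>)), and Re (r \<zeta>) = (t / 2) (\<sigma> Re r +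
      \<sigma>' Im r).\<close>
    define \<zeta> where "\<zeta> = of_real (t / 2) * Complex \<sigma> (- \<sigma>')"
    have "(\<lambda>p. norm (case p of (n, r) \<Rightarrow> c (n, r) * e (of_nat n * \<tau> + r * (- \<i> * \<zeta>) + cnj r * (- \<i> * cnj \<zeta>))))
            summable_on fourier_index m"
      using has_sum_imp_summable[OF expansion[OF \<tau>]]
      by (subst summable_on_iff_abs_summable_on_complex[symmetric])
    also have "(\<lambda>p. norm (case p of (n, r) \<Rightarrow> c (n, r) * e (of_nat n * \<tau> + r * (- \<i> * \<zeta>) + cnj r * (- \<i> * cnj \<zeta>))))
        = ?g \<sigma> \<sigma>'"
      by (auto simp: fun_eq_iff norm_mult norm_e \<zeta>_def exp_add[symmetric] algebra_simps)
    finally show ?thesis .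
  qed
  have "(\<lambda>p. (?g 1 1 p + ?g 1 (-1) p) + (?g (-1) 1 p + ?g (-1) (-1) p)) summable_on fourier_index m"
    by (intro summable_on_add g)
  then have "(\<lambda>p. norm (case p of (n, r) \<Rightarrow> norm (c (n, r)) * exp (- 2 * pi * real n * Im \<tau>) * exp (2 * pi * t * norm r)))
           summable_on fourier_index m"
  proof (rule Infinite_Sum.abs_summable_on_comparison_test', goal_cases)
    case (1 p)
    obtain n r where p: "p = (n, r)" by fastforce
    have "norm r \<le> \<bar>Re r\<bar> + \<bar>Im r\<bar>"
      by (rule cmod_le)
    then have "exp (2 * pi * t * norm r) \<le> exp (2 * pi * t * (\<bar>Re r\<bar> + \<bar>Im r\<bar>))"
      using t by (simp add: mult_left_mono)
    \<comment> \<open>The summand whose signs match those of Re r and Im r equals the left-hand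
      side; the other three are positive.\<close>
    also have "\<dots> \<le> exp (2 * pi * t * (1 * Re r + 1 * Im r)) + exp (2 * pi * t * (1 * Re r + (-1) * Im r)) +
        (exp (2 * pi * t * ((-1) * Re r + 1 * Im r)) + exp (2 * pi * t * ((-1) * Re r + (-1) * Im r)))"
      by (cases "Re r \<ge> 0"; cases "Im r \<ge> 0") (auto intro!: add_nonneg_nonneg add_increasing add_increasing2)
    finally have "norm (c (n, r)) * exp (- 2 * pi * real n * Im \<tau>) * exp (2 * pi * t * norm r) \<le>
       norm (c (n, r)) * exp (- 2 * pi * real n * Im \<tau>) * (exp (2 * pi * t * (1 * Re r + 1 * Im r)) + exp (2 * pi * t * (1 * Re r + (-1) * Im r)) +
        (exp (2 * pi * t * ((-1) * Re r + 1 * Im r)) + exp (2 * pi * t * ((-1) * Re r + (-1) * Im r))))"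
      by (intro mult_left_mono) auto
    then show ?case
      unfolding p prod.case by (subst real_norm_def, subst abs_of_nonneg) (auto simp: distrib_left)
  qed
  then show ?thesis
    by (simp add: case_prod_unfold)
qed

definition taylor_term :: "complex \<Rightarrow> complex \<Rightarrow> complex \<Rightarrow> (nat \<times> complex) \<times> nat \<times> nat \<Rightarrow> complex" where
  "taylor_term \<tau> z1 z2 = (\<lambda>((n, r), (\<alpha>, \<beta>)). c (n, r) * e (of_nat n * \<tau>) *
     ((2 * of_real pi * \<i> * r * z1) ^ \<alpha> / fact \<alpha> * ((2 * of_real pi * \<i> * cnj r * z2) ^ \<beta> / fact \<beta>)))"

text \<open>Summing absolute values over both Taylor exponents produces an exponential of a multiple
  of \<open>norm r\<close>, which \<open>summable_exp_norm\<close> controls. Every later regrouping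
  of the expansion relies on this joint summability.\<close>

lemma taylor_term_summable:
  assumes \<tau>: "\<tau> \<in> uhp"
  shows "taylor_term \<tau> z1 z2 summable_on fourier_index m \<times> UNIV"
proof -
  let ?g = "\<lambda>(n, r). norm (c (n, r)) * exp (- 2 * pi * real n * Im \<tau>) * exp (2 * pi * (norm z1 + norm z2) * norm r)"
  have "(\<lambda>x. norm (taylor_term \<tau> z1 z2 x)) summable_on (Sigma (fourier_index m) (\<lambda>_. UNIV))"
  proof (rule summable_on_SigmaI)
    show "?g summable_on fourier_index m"
      by (rule summable_exp_norm[OF \<tau>]) simp
    fix p assume "p \<in> fourier_index m"
    obtain n r where p: "p = (n, r)" by fastforce
    show "((\<lambda>q. norm (taylor_term \<tau> z1 z2 (p, q))) has_sum ?g p) UNIV"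
    proof -
      let ?x = "2 * of_real pi * \<i> * r * z1" and ?y = "2 * of_real pi * \<i> * cnj r * z2"
      let ?A = "norm (c (n, r) * e (of_nat n * \<tau>))"
      have "((\<lambda>q. ?A * (case q of (i, j) \<Rightarrow> norm (?x ^ i / fact i * (?y ^ j / fact j))))
          has_sum ?A * (exp (norm ?x) * exp (norm ?y))) UNIV"
        by (rule has_sum_cmult_right[OF abs_summable_exp_product])
      also have "(\<lambda>q. ?A * (case q of (i, j) \<Rightarrow> norm (?x ^ i / fact i * (?y ^ j / fact j)))) =
          (\<lambda>q. norm (taylor_term \<tau> z1 z2 (p, q)))"
      proof (rule ext)
        fix q :: "nat \<times> nat"
        show "?A * (case q of (i, j) \<Rightarrow> norm (?x ^ i / fact i * (?y ^ j / fact j))) =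
            norm (taylor_term \<tau> z1 z2 (p, q))"
          by (cases q) (simp only: p taylor_term_def norm_mult prod.case)
      qed
      also have "?A * (exp (norm ?x) * exp (norm ?y)) = ?g p"
        by (simp add: p norm_mult norm_e exp_add[symmetric] algebra_simps)
      finally show ?thesis .
    qed
  qed auto
  then show ?thesis
    by (subst summable_on_iff_abs_summable_on_complex)
qed

text \<open>Each term is a monomial in z1 and z2, so evaluation at (1, 1) extracts its
  coefficient.\<close>

definition taylor_coeff :: "complex \<Rightarrow> nat \<Rightarrow> nat \<Rightarrow> complex" where
  "taylor_coeff \<tau> \<alpha> \<beta> = (\<Sum>\<^sub>\<infinity>p\<in>fourier_index m. taylor_term \<tau> 1 1 (p, (\<alpha>, \<beta>)))"

lemma taylor_coeff:
  assumes \<tau>: "\<tau> \<in> uhp"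
  shows "((\<lambda>p. taylor_term \<tau> z1 z2 (p, (\<alpha>, \<beta>))) has_sum taylor_coeff \<tau> \<alpha> \<beta> * z1 ^ \<alpha> * z2 ^ \<beta>) (fourier_index m)"
proof -
  have "taylor_term \<tau> 1 1 summable_on fourier_index m \<times> UNIV"
    by (rule taylor_term_summable[OF \<tau>])
  then have "(\<lambda>(q, p). taylor_term \<tau> 1 1 (p, q)) summable_on UNIV \<times> fourier_index m"
    by (subst summable_on_swap[symmetric])
  from summable_on_SigmaD1[OF this, of "(\<alpha>, \<beta>)"]
  have "((\<lambda>p. taylor_term \<tau> 1 1 (p, (\<alpha>, \<beta>))) has_sum taylor_coeff \<tau> \<alpha> \<beta>) (fourier_index m)"
    by (simp add: taylor_coeff_def)
  from has_sum_cmult_left[OF this, of "z1 ^ \<alpha> * z2 ^ \<beta>"] show ?thesis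
    by (simp add: taylor_term_def case_prod_unfold power_mult_distrib mult_ac)
qed

lemma double_series_taylor:
  assumes \<tau>: "\<tau> \<in> uhp"
  shows "double_series 1 (taylor_coeff \<tau>) (f \<tau>)"
  unfolding double_series_def
proof (intro allI impI)
  fix z1 z2 :: complex
  show "((\<lambda>(\<alpha>, \<beta>). taylor_coeff \<tau> \<alpha> \<beta> * z1 ^ \<alpha> * z2 ^ \<beta>) has_sum f \<tau> z1 z2) UNIV"
  proof (rule has_sum_exchange[OF taylor_term_summable[OF \<tau>, of z1 z2]])
    show "((\<lambda>(n, r). c (n, r) * e (of_nat n * \<tau> + r * z1 + cnj r * z2)) has_sum f \<tau> z1 z2) (fourier_index m)"
      by (rule expansion[OF \<tau>])
    fix p assume "p \<in> fourier_index m"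
    obtain n r where p: "p = (n, r)" by fastforce
    show "((\<lambda>q. taylor_term \<tau> z1 z2 (p, q)) has_sum (case p of (n, r) \<Rightarrow> c (n, r) * e (of_nat n * \<tau> + r * z1 + cnj r * z2))) UNIV"
      using has_sum_cmult_right[OF has_sum_exp_product[of "2 * of_real pi * \<i> * r * z1" "2 * of_real pi * \<i> * cnj r * z2"],
          of "c (n, r) * e (of_nat n * \<tau>)"]
      by (simp add: p taylor_term_def case_prod_unfold e_def exp_add algebra_simps)
  next
    fix q :: "nat \<times> nat"
    show "((\<lambda>p. taylor_term \<tau> z1 z2 (p, q)) has_sum
       (case q of (\<alpha>, \<beta>) \<Rightarrow> taylor_coeff \<tau> \<alpha> \<beta> * z1 ^ \<alpha> * z2 ^ \<beta>)) (fourier_index m)"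
      using taylor_coeff[OF \<tau>] by (cases q) simp
  qed
qed

text \<open>\<open>chi\<close> is built from iterated partial derivatives at the origin; the double
  power series turns them into explicit sums over (n, r).\<close>

lemma chi_eq_taylor_coeff:
  assumes "\<tau> \<in> uhp"
  shows "chi f \<alpha> \<beta> \<tau> = taylor_coeff \<tau> \<alpha> \<beta>"
proof -
  have pd: "pd_z1 g \<tau> = deriv_left (g \<tau>)" "pd_z2 g \<tau> = deriv_right (g \<tau>)" for g
    by (simp_all add: pd_z1_def pd_z2_def deriv_left_def deriv_right_def fun_eq_iff)
  have 2: "(pd_z2 ^^ \<beta>) g \<tau> = (deriv_right ^^ \<beta>) (g \<tau>)" for g
    by (induction \<beta>) (simp_all add: pd)
  have 1: "(pd_z1 ^^ \<alpha>) g \<tau> = (deriv_left ^^ \<alpha>) (g \<tau>)" for g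
    by (induction \<alpha>) (simp_all add: pd)
  show ?thesis
    using double_series_mixed_derivative_at_0[OF double_series_taylor[OF assms], of \<alpha> \<beta>]
    by (simp add: chi_def 1 2)
qed

text \<open>The part \<alpha> = \<beta> = \<nu> of the Taylor expansion depends on z1 and z2 only
  through s = z1 z2, since (2 \<pi> i r z1)(2 \<pi> i \<open>cnj r\<close> z2) = - 4 \<pi>^2 N(r) s.
  Here x stands for q = \<open>e \<tau>\<close> but is a free variable of the unit disc, including
  0.\<close>

definition diagonal_term :: "complex \<Rightarrow> complex \<Rightarrow> (nat \<times> complex) \<times> nat \<Rightarrow> complex" where
  "diagonal_term x s = (\<lambda>((n, r), \<nu>). c (n, r) * x ^ n * ((- 4 * of_real (pi\<^sup>2 * normK r) * s) ^ \<nu> / (fact \<nu>)\<^sup>2))"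

lemma diagonal_term_eq_taylor_term: "diagonal_term (e \<tau>) s (p, \<nu>) = taylor_term \<tau> 1 s (p, (\<nu>, \<nu>))"
proof (cases p)
  case (Pair n r)
  have "(- 4 * of_real (pi\<^sup>2 * normK r) * s) = (2 * of_real pi * \<i> * r * 1) * (2 * of_real pi * \<i> * cnj r * s)"
    by (simp add: of_real_normK power2_eq_square algebra_simps)
  then have "(- 4 * of_real (pi\<^sup>2 * normK r) * s) ^ \<nu> / (fact \<nu>)\<^sup>2 =
      (2 * of_real pi * \<i> * r * 1) ^ \<nu> / fact \<nu> * ((2 * of_real pi * \<i> * cnj r * s) ^ \<nu> / fact \<nu>)"
    by (simp only: power_mult_distrib power2_eq_square times_divide_times_eq)
  then show ?thesis
    by (simp only: Pair diagonal_term_def taylor_term_def prod.case e_of_nat_mult)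
qed

text \<open>The diagonal is a subfamily of the summable Taylor family, and lowering |x| only shrinks
  the terms. Hence it suffices to dominate x by a value \<open>e \<tau>\<close> with \<tau> on the
  imaginary axis.\<close>

lemma diagonal_term_summable:
  assumes "norm x < 1"
  shows "diagonal_term x s summable_on fourier_index m \<times> UNIV"
proof -
  \<comment> \<open>The maximum with 1/2 covers x = 0, a modulus that \<open>e\<close> does not
    attain.\<close>
  define \<xi> where "\<xi> = max (norm x) (1 / 2)"
  have \<xi>: "0 < \<xi>" "\<xi> < 1" "norm x \<le> \<xi>"
    using assms by (auto simp: \<xi>_def)
  define \<tau> where "\<tau> = \<i> * of_real (- ln \<xi> / (2 * pi))"
  have e\<tau>: "norm (e \<tau>) = \<xi>"
    using \<xi> by (simp add: norm_e \<tau>_def)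
  have \<tau>: "\<tau> \<in> uhp"
    using \<xi> by (simp add: uhp_def \<tau>_def divide_neg_pos)
  have inj: "inj_on (\<lambda>(p, \<nu>). (p, (\<nu>, \<nu>))) (fourier_index m \<times> UNIV)"
    by (auto simp: inj_on_def)
  have "taylor_term \<tau> 1 s summable_on (\<lambda>(p, \<nu>). (p, (\<nu>, \<nu>))) ` (fourier_index m \<times> UNIV)"
    using taylor_term_summable[OF \<tau>] by (rule summable_on_subset) auto
  then have "(taylor_term \<tau> 1 s \<circ> (\<lambda>(p, \<nu>). (p, (\<nu>, \<nu>)))) summable_on (fourier_index m \<times> UNIV)"
    by (subst (asm) summable_on_reindex[OF inj])
  also have "taylor_term \<tau> 1 s \<circ> (\<lambda>(p, \<nu>). (p, (\<nu>, \<nu>))) = diagonal_term (e \<tau>) s"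
    by (auto simp: fun_eq_iff diagonal_term_eq_taylor_term)
  finally have "(\<lambda>q. norm (diagonal_term (e \<tau>) s q)) summable_on fourier_index m \<times> UNIV"
    by (subst (asm) summable_on_iff_abs_summable_on_complex)
  then have "(\<lambda>q. norm (diagonal_term x s q)) summable_on fourier_index m \<times> UNIV"
  proof (rule Infinite_Sum.abs_summable_on_comparison_test', goal_cases)
    case (1 q)
    obtain n r \<nu> where q: "q = ((n, r), \<nu>)"
      by (metis surj_pair)
    have "norm (x ^ n) \<le> norm (e \<tau> ^ n)"
      using \<xi> by (simp add: norm_power e\<tau> power_mono)
    then show ?case
      unfolding q diagonal_term_def prod.case norm_mult[of "_ * _ ^ n"] norm_mult[of _ "_ ^ n"]
      by (intro mult_right_mono mult_left_mono) auto
  qed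
  then show ?thesis
    by (subst summable_on_iff_abs_summable_on_complex)
qed

definition diagonal_coeff :: "nat \<Rightarrow> nat \<Rightarrow> complex" where
  "diagonal_coeff n \<nu> = (\<Sum>r\<in>dual_ball m n. c (n, r) * (- 4 * of_real (pi\<^sup>2 * normK r)) ^ \<nu> / (fact \<nu>)\<^sup>2)"

definition diagonal_sum :: "complex \<Rightarrow> complex \<Rightarrow> complex" where
  "diagonal_sum x s = (\<Sum>\<^sub>\<infinity>q\<in>fourier_index m \<times> UNIV. diagonal_term x s q)"

text \<open>For fixed n and \<nu> only finitely many r occur, so the sum over r can be performed
  first.\<close>

lemma double_series_diagonal: "double_series 1 diagonal_coeff diagonal_sum"
  unfolding double_series_def
proof (intro allI impI)
  fix x s :: complex assume x: "norm x < 1"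
  have "(diagonal_term x s has_sum diagonal_sum x s) (fourier_index m \<times> UNIV)"
    unfolding diagonal_sum_def using diagonal_term_summable[OF x] by (rule has_sum_infsum)
  then have "((\<lambda>((n, \<nu>), r). diagonal_term x s ((n, r), \<nu>)) has_sum diagonal_sum x s)
      (Sigma UNIV (\<lambda>(n, \<nu>). dual_ball m n))"
    by (rule has_sum_reindex_bij_witness[of _ "\<lambda>((n, \<nu>), r). ((n, r), \<nu>)" "\<lambda>((n, r), \<nu>). ((n, \<nu>), r)",
          THEN iffD1, rotated -1])
       (auto simp: fourier_index_eq_Sigma)
  then show "((\<lambda>(n, \<nu>). diagonal_coeff n \<nu> * x ^ n * s ^ \<nu>) has_sum diagonal_sum x s) UNIV"
  proof (rule has_sum_SigmaD, goal_cases)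
    case (1 q)
    obtain n \<nu> where q: "q = (n, \<nu>)" by fastforce
    have "diagonal_coeff n \<nu> * x ^ n * s ^ \<nu> = (\<Sum>r\<in>dual_ball m n. diagonal_term x s ((n, r), \<nu>))"
      unfolding diagonal_coeff_def sum_distrib_right
    proof (intro sum.cong refl)
      fix r
      have "(- 4 * of_real (pi\<^sup>2 * normK r) * s) ^ \<nu> = (- 4 * of_real (pi\<^sup>2 * normK r)) ^ \<nu> * s ^ \<nu>"
        by (rule power_mult_distrib)
      then show "c (n, r) * (- 4 * of_real (pi\<^sup>2 * normK r)) ^ \<nu> / (fact \<nu>)\<^sup>2 * x ^ n * s ^ \<nu> =
          diagonal_term x s ((n, r), \<nu>)"
        by (simp only: diagonal_term_def prod.case) (simp add: mult_ac)
    qed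
    then show ?case
      unfolding q prod.case by (intro has_sum_finiteI finite_dual_ball)
  qed
qed

lemma phi0_eq_diagonal_sum:
  assumes \<tau>: "\<tau> \<in> uhp"
  shows "phi0 f \<tau> z1 z2 = diagonal_sum (e \<tau>) (z1 * z2)"
proof -
  have x: "norm (e \<tau>) < 1"
    using \<tau> by (simp add: norm_e uhp_def)
  have "(diagonal_term (e \<tau>) (z1 * z2) has_sum diagonal_sum (e \<tau>) (z1 * z2)) (fourier_index m \<times> UNIV)"
    unfolding diagonal_sum_def using diagonal_term_summable[OF x] by (rule has_sum_infsum)
  then have "((\<lambda>(\<nu>, p). diagonal_term (e \<tau>) (z1 * z2) (p, \<nu>)) has_sum diagonal_sum (e \<tau>) (z1 * z2)) (UNIV \<times> fourier_index m)"
    by (subst has_sum_swap[symmetric])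
  then have "((\<lambda>\<nu>. chi f \<nu> \<nu> \<tau> * (z1 * z2) ^ \<nu>) has_sum diagonal_sum (e \<tau>) (z1 * z2)) UNIV"
  proof (rule has_sum_SigmaD, goal_cases)
    case (1 \<nu>)
    then show ?case
      using taylor_coeff[OF \<tau>, of 1 "z1 * z2" \<nu> \<nu>]
      by (simp add: chi_eq_taylor_coeff[OF \<tau>] diagonal_term_eq_taylor_term)
  qed
  then show ?thesis
    unfolding phi0_def by (metis has_sum_imp_sums sums_unique)
qed

end

section \<open>The operators on diagonal coefficients\<close>

text \<open>In terms of \<open>q = e \<tau>\<close> and \<open>s = z1 * z2\<close> the operator \<open>Lop k m\<close> becomes
  \<open>- 16 \<pi>\<^sup>2 m q \<partial>\<^sub>q - 4 k \<partial>\<^sub>s - 4 s \<partial>\<^sub>s\<^sup>2\<close>;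
  this is its action on coefficients.\<close>

definition heat_coeff :: "nat \<Rightarrow> nat \<Rightarrow> (nat \<Rightarrow> nat \<Rightarrow> complex) \<Rightarrow> nat \<Rightarrow> nat \<Rightarrow> complex" where
  "heat_coeff k m a n j =
     - 16 * of_real (pi\<^sup>2) * of_nat m * of_nat n * a n j - 4 * of_nat (Suc j) * of_nat (k + j) * a n (Suc j)"

text \<open>The representation is demanded only for nonzero z1 and z2: \<open>Lop\<close> divides by
  both, and division by zero yields 0, so the values on the axes are not those of the continuous
  extension.\<close>

definition diagonal_rep :: "(nat \<Rightarrow> nat \<Rightarrow> complex) \<Rightarrow> (complex \<Rightarrow> complex \<Rightarrow> complex \<Rightarrow> complex) \<Rightarrow> bool" where
  "diagonal_rep a g \<longleftrightarrow> (\<exists>h. double_series 1 a h \<and>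
     (\<forall>\<tau>\<in>uhp. \<forall>z1 z2. z1 \<noteq> 0 \<longrightarrow> z2 \<noteq> 0 \<longrightarrow> g \<tau> z1 z2 = h (e \<tau>) (z1 * z2)))"

lemma norm_e_less_1: "\<tau> \<in> uhp \<Longrightarrow> norm (e \<tau>) < 1"
  by (simp add: norm_e uhp_def)

lemma deriv_eq_if_eq_on_open:
  assumes "(g has_field_derivative D) (at x)" "open S" "x \<in> S" "\<And>w. w \<in> S \<Longrightarrow> f w = g w"
  shows "deriv f x = D"
proof -
  have "(f has_field_derivative D) (at x)"
    using has_field_derivative_transform_within_open[OF assms(1-3)] assms(4) by metis
  then show ?thesis
    by (rule DERIV_imp_deriv)
qed

text \<open>The apparent poles cancel: differentiating h(q, z1 z2) in z2 produces a factor z1, and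
  symmetrically. The two singular terms contribute - (4k - 4) \<partial>h/\<partial>s, the mixed
  derivative adds another - 4 \<partial>h/\<partial>s, and 8 \<pi> i m times 2 \<pi> i gives - 16
  \<pi>^2 m.\<close>

lemma diagonal_rep_Lop:
  assumes "diagonal_rep a g"
  shows "diagonal_rep (heat_coeff k m a) (Lop k m g)"
proof -
  obtain h where h: "double_series 1 a h"
    and g: "\<And>\<tau> z1 z2. \<tau> \<in> uhp \<Longrightarrow> z1 \<noteq> 0 \<Longrightarrow> z2 \<noteq> 0 \<Longrightarrow> g \<tau> z1 z2 = h (e \<tau>) (z1 * z2)"
    using assms by (auto simp: diagonal_rep_def)
  define hx where "hx = deriv_left h"
  define hs where "hs = deriv_right h"
  define hss where "hss = deriv_right hs"
  have dhx: "double_series 1 (shift_left a) hx" and dhs: "double_series 1 (shift_right a) hs"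
    unfolding hx_def hs_def using h by (auto intro: double_series_deriv_left double_series_deriv_right)
  have dhss: "double_series 1 (shift_right (shift_right a)) hss"
    unfolding hss_def by (intro double_series_deriv_right dhs)
  define h' where "h' x s = - 16 * of_real (pi\<^sup>2) * of_nat m * (x * hx x s) +
      (- 4 * of_nat k * hs x s + - 4 * (s * hss x s))" for x s
  have "double_series 1 (\<lambda>n j. - 16 * of_real (pi\<^sup>2) * of_nat m * (case n of 0 \<Rightarrow> 0 | Suc n' \<Rightarrow> shift_left a n' j) +
      (- 4 * of_nat k * shift_right a n j + - 4 * (case j of 0 \<Rightarrow> 0 | Suc j' \<Rightarrow> shift_right (shift_right a) n j'))) h'"
    unfolding h'_def[abs_def]
    by (intro double_series_add double_series_scale double_series_mult_left double_series_mult_right dhx dhs dhss)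
  also have "(\<lambda>n j. - 16 * of_real (pi\<^sup>2) * of_nat m * (case n of 0 \<Rightarrow> 0 | Suc n' \<Rightarrow> shift_left a n' j) +
      (- 4 * of_nat k * shift_right a n j + - 4 * (case j of 0 \<Rightarrow> 0 | Suc j' \<Rightarrow> shift_right (shift_right a) n j')))
    = heat_coeff k m a"
    by (intro ext) (auto simp: heat_coeff_def shift_left_def shift_right_def algebra_simps split: nat.splits)
  finally have dh': "double_series 1 (heat_coeff k m a) h'" .
  have "Lop k m g \<tau> z1 z2 = h' (e \<tau>) (z1 * z2)" if \<tau>: "\<tau> \<in> uhp" and z: "z1 \<noteq> 0" "z2 \<noteq> 0" for \<tau> z1 z2
  proof -
    have pt: "pd_tau g \<tau> z1 z2 = hx (e \<tau>) (z1 * z2) * (2 * of_real pi * \<i> * e \<tau>)"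
      unfolding pd_tau_def
    proof (rule deriv_eq_if_eq_on_open[OF _ open_uhp \<tau>])
      have "((\<lambda>w. h w (z1 * z2)) has_field_derivative hx (e \<tau>) (z1 * z2)) (at (e \<tau>))"
        unfolding hx_def by (rule double_series_has_derivative_left[OF h norm_e_less_1[OF \<tau>]])
      from DERIV_chain2[OF this e_has_field_derivative]
      show "((\<lambda>t. h (e t) (z1 * z2)) has_field_derivative hx (e \<tau>) (z1 * z2) * (2 * of_real pi * \<i> * e \<tau>)) (at \<tau>)" .
    qed (use g z in auto)
    have hs': "((\<lambda>w. h (e \<tau>) (l w)) has_field_derivative hs (e \<tau>) (l w) * D) (at w)"
      if "(l has_field_derivative D) (at w)" for l w D
      unfolding hs_def
      by (rule DERIV_chain2[OF double_series_has_derivative_right(1)[OF h norm_e_less_1[OF \<tau>]] that])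
    have hss': "((\<lambda>w. hs (e \<tau>) (l w)) has_field_derivative hss (e \<tau>) (l w) * D) (at w)"
      if "(l has_field_derivative D) (at w)" for l w D
      unfolding hss_def
      by (rule DERIV_chain2[OF double_series_has_derivative_right(1)[OF dhs norm_e_less_1[OF \<tau>]] that])
    have open0: "open (- {0 :: complex})"
      by auto
    \<comment> \<open>Stated for all nonzero w, not just z1, because the result is differentiated in
      this variable below.\<close>
    have p2: "pd_z2 g \<tau> w z2 = hs (e \<tau>) (w * z2) * w" if "w \<noteq> 0" for w
      unfolding pd_z2_def
    proof (rule deriv_eq_if_eq_on_open[OF hs' open0])
      show "((\<lambda>v. w * v) has_field_derivative w) (at z2)"
        by (auto intro!: derivative_eq_intros)
    qed (use g \<tau> z that in auto)
    have p1: "pd_z1 g \<tau> z1 z2 = hs (e \<tau>) (z1 * z2) * z2"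
      unfolding pd_z1_def
    proof (rule deriv_eq_if_eq_on_open[OF hs' open0])
      show "((\<lambda>v. v * z2) has_field_derivative z2) (at z1)"
        by (auto intro!: derivative_eq_intros)
    qed (use g \<tau> z in auto)
    have p12: "pd_z1 (pd_z2 g) \<tau> z1 z2 = hss (e \<tau>) (z1 * z2) * z2 * z1 + hs (e \<tau>) (z1 * z2)"
      unfolding pd_z1_def
    proof (rule deriv_eq_if_eq_on_open[OF _ open0])
      have "((\<lambda>v. v * z2) has_field_derivative z2) (at z1)"
        by (auto intro!: derivative_eq_intros)
      from DERIV_mult[OF hss'[OF this] DERIV_ident]
      show "((\<lambda>w. hs (e \<tau>) (w * z2) * w) has_field_derivative
          hss (e \<tau>) (z1 * z2) * z2 * z1 + hs (e \<tau>) (z1 * z2)) (at z1)"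
        by (simp add: mult_ac)
    qed (use p2 z in auto)
    show ?thesis
      unfolding Lop_def pt p1 p2[OF z(1)] p12 h'_def using z
      by (simp add: field_simps power2_eq_square)
  qed
  then show ?thesis
    using dh' unfolding diagonal_rep_def by blast
qed

fun heat_iterate :: "nat \<Rightarrow> nat \<Rightarrow> (nat \<Rightarrow> nat \<Rightarrow> complex) \<Rightarrow> nat \<Rightarrow> nat \<Rightarrow> nat \<Rightarrow> complex" where
  "heat_iterate k m a 0 = a"
| "heat_iterate k m a (Suc \<nu>) = heat_coeff (k + 2 * \<nu>) m (heat_iterate k m a \<nu>)"

lemma diagonal_rep_Dtilde:
  "diagonal_rep a g \<Longrightarrow> diagonal_rep (heat_iterate k m a \<nu>) (Dtilde k m \<nu> g)"
  by (induction \<nu>) (auto intro: diagonal_rep_Lop)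

text \<open>The limit exists because h is continuous in s; setting s = 0 leaves column 0 of the
  coefficients.\<close>

lemma Lim_diagonal_rep:
  assumes "diagonal_rep a g" and \<tau>: "\<tau> \<in> uhp"
  shows "(\<lambda>n. a n 0 * e \<tau> ^ n) sums
    Lim (at (0, 0) within {p :: complex \<times> complex. fst p \<noteq> 0 \<and> snd p \<noteq> 0}) (\<lambda>(z1, z2). g \<tau> z1 z2)"
    (is "_ sums Lim ?F _")
proof -
  obtain h where h: "double_series 1 a h"
    and g: "\<And>\<tau> z1 z2. \<tau> \<in> uhp \<Longrightarrow> z1 \<noteq> 0 \<Longrightarrow> z2 \<noteq> 0 \<Longrightarrow> g \<tau> z1 z2 = h (e \<tau>) (z1 * z2)"
    using assms by (auto simp: diagonal_rep_def)
  have "isCont (\<lambda>s. h (e \<tau>) s) 0"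
    using double_series_has_derivative_right(1)[OF h norm_e_less_1[OF \<tau>]] by (rule DERIV_isCont)
  moreover have "((\<lambda>p. fst p * snd p) \<longlongrightarrow> 0) ?F"
    by (auto intro!: tendsto_eq_intros)
  ultimately have "((\<lambda>p. h (e \<tau>) (fst p * snd p)) \<longlongrightarrow> h (e \<tau>) 0) ?F"
    by (rule isCont_tendsto_compose)
  moreover have "\<forall>\<^sub>F p in ?F. h (e \<tau>) (fst p * snd p) = (case p of (z1, z2) \<Rightarrow> g \<tau> z1 z2)"
    unfolding eventually_at_filter by (intro always_eventually allI impI) (auto simp: g[OF \<tau>])
  ultimately have lim: "((\<lambda>(z1, z2). g \<tau> z1 z2) \<longlongrightarrow> h (e \<tau>) 0) ?F"
    by (rule Lim_transform_eventually)
  \<comment> \<open>\<open>Lim\<close> is determined only along a nontrivial filter; the points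
    (1/(n+1), 1/(n+1)) show that the origin is approached with both coordinates nonzero.\<close>
  have "(0, 0) islimpt {p :: complex \<times> complex. fst p \<noteq> 0 \<and> snd p \<noteq> 0}"
    unfolding islimpt_sequential
  proof (intro exI conjI allI)
    let ?x = "\<lambda>n. inverse (of_nat (Suc n)) :: complex"
    show "(\<lambda>n. (?x n, ?x n)) \<longlonglongrightarrow> (0, 0)"
      by (intro tendsto_Pair LIMSEQ_Suc[OF lim_inverse_n])
  qed (auto simp del: of_nat_Suc)
  then have "?F \<noteq> bot"
    by (simp add: trivial_limit_within)
  then have "Lim ?F (\<lambda>(z1, z2). g \<tau> z1 z2) = h (e \<tau>) 0"
    using lim by (rule tendsto_Lim)
  then show ?thesis
    using double_series_at_0_right[OF h norm_e_less_1[OF \<tau>]] by simp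
qed

section \<open>Recovering the diagonal coefficients from the functions \<open>Dop\<close>\<close>

lemma e_surj_punctured_disc:
  assumes "x \<noteq> 0" "norm x < 1"
  obtains \<tau> where "\<tau> \<in> uhp" "e \<tau> = x"
proof
  let ?\<tau> = "Ln x / (2 * of_real pi * \<i>)"
  show "e ?\<tau> = x"
    using assms by (simp add: e_def)
  have "Im ?\<tau> = - ln (norm x) / (2 * pi)"
    using assms by (simp add: Im_divide power2_eq_square)
  then show "?\<tau> \<in> uhp"
    using assms by (simp add: uhp_def divide_neg_pos)
qed

text \<open>The point x = 0 is left out of the hypothesis because \<open>e\<close> never takes the
  value 0. Continuity supplies it, and a nonzero coefficient would make this zero isolated.\<close>

lemma power_series_eq_0:
  fixes a :: "nat \<Rightarrow> complex"
  assumes "\<And>x. x \<noteq> 0 \<Longrightarrow> norm x < 1 \<Longrightarrow> (\<lambda>n. a n * x ^ n) sums 0"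
  shows "a n = 0"
proof (rule ccontr)
  assume n: "a n \<noteq> 0"
  define f where "f x = (\<Sum>n. a n * x ^ n)" for x
  have sums: "(\<lambda>n. a n * x ^ n) sums f x" if "norm x < 1" for x
    using assms[of x] that powser_sums_zero[of a]
    by (cases "x = 0") (auto simp: f_def sums_iff)
  have f: "f x = 0" if "x \<noteq> 0" "norm x < 1" for x
    using assms[OF that] by (simp add: f_def sums_iff)
  have "f 0 = 0"
  proof -
    have "isCont f 0"
      unfolding f_def using sums[of "1 / 2"] by (intro isCont_powser[of _ "1 / 2"]) (auto simp: sums_iff)
    then have "(f \<longlongrightarrow> f 0) (at 0)"
      by (simp add: isCont_def)
    moreover have "(f \<longlongrightarrow> 0) (at 0)"
      by (rule tendsto_eventually) (auto simp: eventually_at f intro!: exI[of _ 1])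
    ultimately show ?thesis
      using tendsto_unique at_neq_bot by blast
  qed
  moreover from this have "n > 0"
    using n sums[of 0] powser_sums_zero[of a] by (cases n) (auto dest: sums_unique2)
  ultimately obtain s where s: "s > 0" "\<And>z. z \<in> cball 0 s - {0} \<Longrightarrow> f z \<noteq> 0"
    using powser_0_nonzero[of 1 0 a f n] sums n by auto
  define z where "z = complex_of_real (min s (1 / 2))"
  have "norm z = min s (1 / 2)"
    using s(1) unfolding z_def norm_of_real by simp
  then have "norm z > 0" "norm z \<le> s" "norm z < 1"
    using s(1) by auto
  then show False
    using s(2)[of z] f[of z] by (simp add: dist_norm)
qed

context fourier_expansion
begin

lemma diagonal_rep_phi0: "diagonal_rep diagonal_coeff (phi0 f)"
  unfolding diagonal_rep_def using double_series_diagonal phi0_eq_diagonal_sum by blast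

lemma Dop_sums:
  assumes "\<tau> \<in> uhp"
  shows "(\<lambda>n. heat_iterate k m diagonal_coeff \<nu> n 0 * e \<tau> ^ n) sums Dop k m \<nu> f \<tau>"
  unfolding Dop_def by (intro Lim_diagonal_rep diagonal_rep_Dtilde diagonal_rep_phi0 assms)

end

text \<open>Column j + 1 of iterate \<nu> is obtained from column j of the iterates \<nu> and \<nu>
  + 1, because it enters \<open>heat_coeff\<close> with the factor 4 (j + 1) (k + 2 \<nu> + j),
  nonzero for k > 0. Each column uses up one iterate, hence the induction over the triangle \<nu> +
  j \<le> N.\<close>

lemma heat_iterate_determines_coeffs:
  assumes k: "k > 0"
    and eq: "\<And>\<nu>. \<nu> \<le> N \<Longrightarrow> heat_iterate k m a \<nu> n 0 = heat_iterate k m b \<nu> n 0"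
    and "j \<le> N"
  shows "a n j = b n j"
proof -
  have "\<nu> + j \<le> N \<longrightarrow> heat_iterate k m a \<nu> n j = heat_iterate k m b \<nu> n j" for \<nu>
  proof (induction j arbitrary: \<nu>)
    case 0
    then show ?case using eq by simp
  next
    case (Suc j)
    show ?case
    proof
      assume "\<nu> + Suc j \<le> N"
      then have "heat_iterate k m a \<nu> n j = heat_iterate k m b \<nu> n j"
        "heat_iterate k m a (Suc \<nu>) n j = heat_iterate k m b (Suc \<nu>) n j"
        using Suc.IH[of \<nu>] Suc.IH[of "Suc \<nu>"] by auto
      then have "4 * of_nat (Suc j) * of_nat (k + 2 * \<nu> + j) * heat_iterate k m a \<nu> n (Suc j) =
          4 * of_nat (Suc j) * of_nat (k + 2 * \<nu> + j) * heat_iterate k m b \<nu> n (Suc j)"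
        by (simp add: heat_coeff_def)
      moreover have "4 * of_nat (Suc j) * of_nat (k + 2 * \<nu> + j) \<noteq> (0 :: complex)"
        unfolding mult_eq_0_iff of_nat_eq_0_iff using k by simp
      ultimately show "heat_iterate k m a \<nu> n (Suc j) = heat_iterate k m b \<nu> n (Suc j)"
        using mult_left_cancel by blast
    qed
  qed
  from this[of 0] show ?thesis
    using \<open>j \<le> N\<close> by simp
qed

lemma diagonal_coeffs_eq:
  assumes "fourier_expansion m c1 f1" "fourier_expansion m c2 f2" and k: "k > 0"
    and D: "\<And>\<nu> \<tau>. \<nu> \<le> N \<Longrightarrow> \<tau> \<in> uhp \<Longrightarrow> Dop k m \<nu> f1 \<tau> = Dop k m \<nu> f2 \<tau>"
    and j: "j \<le> N"
  shows "fourier_expansion.diagonal_coeff m c1 n j = fourier_expansion.diagonal_coeff m c2 n j"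
proof -
  interpret F1: fourier_expansion m c1 f1 by fact
  interpret F2: fourier_expansion m c2 f2 by fact
  let ?d = "\<lambda>\<nu> n. heat_iterate k m F1.diagonal_coeff \<nu> n 0 - heat_iterate k m F2.diagonal_coeff \<nu> n 0"
  have "?d \<nu> n = 0" if \<nu>: "\<nu> \<le> N" for \<nu> n
  proof (rule power_series_eq_0[of "?d \<nu>"])
    fix x :: complex assume "x \<noteq> 0" "norm x < 1"
    then obtain \<tau> where \<tau>: "\<tau> \<in> uhp" "e \<tau> = x"
      by (rule e_surj_punctured_disc)
    show "(\<lambda>n. ?d \<nu> n * x ^ n) sums 0"
      using sums_diff[OF F1.Dop_sums[OF \<tau>(1), of k \<nu>] F2.Dop_sums[OF \<tau>(1), of k \<nu>]] D[OF \<nu> \<tau>(1)]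
      by (simp add: \<tau>(2) left_diff_distrib)
  qed
  then have "heat_iterate k m F1.diagonal_coeff \<nu> n 0 = heat_iterate k m F2.diagonal_coeff \<nu> n 0" if "\<nu> \<le> N" for \<nu>
    using that eq_iff_diff_eq_0 by blast
  from heat_iterate_determines_coeffs[OF k this j] show ?thesis .
qed

section \<open>Interpolation and the size of the bounds\<close>

text \<open>All factors lie between 0 and 1, so the product decreases when extended to every integer
  from 2 to N + 1, where it telescopes to (N + 2) / (2 (N + 1)).\<close>

lemma prod_inverse_squares_ge_half:
  assumes "finite A" "\<And>p. p \<in> A \<Longrightarrow> p \<ge> (2 :: nat)"
  shows "(\<Prod>p\<in>A. 1 - 1 / real p ^ 2) \<ge> 1 / 2"
proof -
  have telescope: "(\<Prod>p\<in>{2..Suc n}. 1 - 1 / real p ^ 2) = (real n + 2) / (2 * (real n + 1))" for n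
  proof (induction n)
    case (Suc n)
    have "{2..Suc (Suc n)} = insert (Suc (Suc n)) {2..Suc n}"
      by auto
    then have "(\<Prod>p\<in>{2..Suc (Suc n)}. 1 - 1 / real p ^ 2) =
        (1 - 1 / real (Suc (Suc n)) ^ 2) * (\<Prod>p\<in>{2..Suc n}. 1 - 1 / real p ^ 2)"
      by (simp only: finite_atLeastAtMost prod.insert atLeastAtMost_iff) simp
    also have "\<dots> = (1 - 1 / (real n + 2) ^ 2) * ((real n + 2) / (2 * (real n + 1)))"
      unfolding Suc.IH by (simp add: add.commute)
    also have "\<dots> = (real (Suc n) + 2) / (2 * (real (Suc n) + 1))"
    proof -
      have "(1 - 1 / x ^ 2) * (x / (2 * (x - 1))) = (x + 1) / (2 * x)" if "x > 1" for x :: real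
        using that by (simp add: divide_simps) (simp add: power2_eq_square algebra_simps)
      from this[of "real n + 2"] show ?thesis
        by (simp add: add_ac)
    qed
    finally show ?case .
  qed auto
  obtain N where N: "A \<subseteq> {..N}"
    using assms(1) finite_nat_iff_bounded_le by auto
  let ?B = "{2..Suc N}"
  have AB: "A \<subseteq> ?B"
    using N assms(2) by fastforce
  have factor: "0 \<le> 1 - 1 / real p ^ 2" "1 - 1 / real p ^ 2 \<le> 1" if "p \<ge> 2" for p
    using that one_le_power[of "real p" 2] by (auto simp: divide_simps)
  have "(\<Prod>p\<in>?B. 1 - 1 / real p ^ 2) = (\<Prod>p\<in>?B - A. 1 - 1 / real p ^ 2) * (\<Prod>p\<in>A. 1 - 1 / real p ^ 2)"
    using AB by (intro prod.subset_diff) auto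
  also have "\<dots> \<le> 1 * (\<Prod>p\<in>A. 1 - 1 / real p ^ 2)"
    by (intro mult_right_mono prod_le_1 prod_nonneg conjI factor) (use assms(2) AB in auto)
  finally have "(real N + 2) / (2 * (real N + 1)) \<le> (\<Prod>p\<in>A. 1 - 1 / real p ^ 2)"
    by (simp only: telescope mult_1_left)
  moreover have "1 / 2 \<le> (real N + 2) / (2 * (real N + 1))"
    by (simp add: field_simps)
  ultimately show ?thesis
    by linarith
qed

text \<open>With the product bounded by 1/2 the claim becomes 2 (k - 1) / 3 \<ge> k / 2, which is k
  \<ge> 4. The summand 1 undoes the integer part: \<kappa> + 1 is the first index n at which a
  coefficient may survive.\<close>

lemma kappa_lower_bound:
  assumes k: "k \<ge> 4"
  shows "real (kappa k m) + 1 > (real m)\<^sup>2 * real k / 2 + real m / 2"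
proof -
  define X where "X = 4 * real m ^ 2 * (real k - 1) / 3
        * (\<Prod>p\<in>prime_factors (4 * m). (1 - 1 / real p ^ 2)) + real m / 2"
  have "(\<Prod>p\<in>prime_factors (4 * m). (1 - 1 / real p ^ 2)) \<ge> 1 / 2"
    by (rule prod_inverse_squares_ge_half) (auto dest: in_prime_factors_imp_prime intro: prime_ge_2_nat)
  then have "X \<ge> 4 * real m ^ 2 * (real k - 1) / 3 * (1 / 2) + real m / 2"
    unfolding X_def using k by (intro add_right_mono mult_left_mono) auto
  moreover have "4 * real m ^ 2 * (real k - 1) / 3 * (1 / 2) \<ge> (real m)\<^sup>2 * real k / 2"
  proof -
    have "(real m)\<^sup>2 * (real k / 2) \<le> (real m)\<^sup>2 * (2 * (real k - 1) / 3)"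
      using k by (intro mult_left_mono) auto
    then show ?thesis by (simp add: algebra_simps)
  qed
  moreover have "real (kappa k m) + 1 > X"
    unfolding kappa_def X_def[symmetric] by linarith
  ultimately show ?thesis
    by linarith
qed

section \<open>Lattice points in discs and the size of R_0\<close>

lemma finite_sum_of_two_squares: "finite {p :: int \<times> int. fst p ^ 2 + snd p ^ 2 \<le> int D}"
proof (rule finite_subset)
  show "{p :: int \<times> int. fst p ^ 2 + snd p ^ 2 \<le> int D} \<subseteq> {- int D..int D} \<times> {- int D..int D}"
  proof
    fix p :: "int \<times> int" assume p: "p \<in> {p. fst p ^ 2 + snd p ^ 2 \<le> int D}"
    have "\<bar>z\<bar> \<le> z\<^sup>2" for z :: int
      using self_le_power[of "\<bar>z\<bar>" 2] by (cases "z = 0") auto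
    from this[of "fst p"] this[of "snd p"] have "\<bar>fst p\<bar> \<le> int D" "\<bar>snd p\<bar> \<le> int D"
      using p zero_le_power2[of "fst p"] zero_le_power2[of "snd p"] by (auto simp del: zero_le_power2)
    then show "p \<in> {- int D..int D} \<times> {- int D..int D}"
      by (cases p) auto
  qed
qed auto

text \<open>The disc of radius \<open>sqrt D\<close> contains the square of half side \<open>s = \<lfloor>sqrt (D / 2)\<rfloor>\<close>,
  which has \<open>(2 s + 1)\<^sup>2 \<ge> D\<close> lattice points.\<close>

lemma sum_rsq_ge: "D \<le> (\<Sum>d\<in>{0..D}. rsq d)"
proof -
  have "(\<Sum>d\<in>{0..D}. rsq d) = card (\<Union>d\<in>{0..D}. {p :: int \<times> int. fst p ^ 2 + snd p ^ 2 = int d})"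
    unfolding rsq_def
    by (rule card_UN_disjoint[symmetric]) (auto intro: finite_subset[OF _ finite_sum_of_two_squares])
  also have "(\<Union>d\<in>{0..D}. {p :: int \<times> int. fst p ^ 2 + snd p ^ 2 = int d}) =
      {p. fst p ^ 2 + snd p ^ 2 \<le> int D}"
  proof (intro set_eqI iffI)
    fix p :: "int \<times> int" assume "p \<in> {p. fst p ^ 2 + snd p ^ 2 \<le> int D}"
    then show "p \<in> (\<Union>d\<in>{0..D}. {p :: int \<times> int. fst p ^ 2 + snd p ^ 2 = int d})"
      by (intro UN_I[of "nat (fst p ^ 2 + snd p ^ 2)"]) auto
  qed auto
  finally have sum: "(\<Sum>d\<in>{0..D}. rsq d) = card {p :: int \<times> int. fst p ^ 2 + snd p ^ 2 \<le> int D}" .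
  define s where "s = nat \<lfloor>sqrt (real D / 2)\<rfloor>"
  have s: "real s \<le> sqrt (real D / 2)" "sqrt (real D / 2) < real s + 1"
    unfolding s_def by (simp_all add: of_nat_nat)
  have "(real s)\<^sup>2 \<le> (sqrt (real D / 2))\<^sup>2" "(sqrt (real D / 2))\<^sup>2 < (real s + 1)\<^sup>2"
    using s by (intro power_mono power_strict_mono; simp)+
  then have "real (2 * s\<^sup>2) \<le> real D" "real D < real (2 * (s + 1)\<^sup>2)"
    by (auto simp: field_simps)
  then have s2: "2 * s\<^sup>2 \<le> D" "D < 2 * (s + 1)\<^sup>2"
    unfolding of_nat_le_iff of_nat_less_iff by auto
  have "{- int s..int s} \<times> {- int s..int s} \<subseteq> {p :: int \<times> int. fst p ^ 2 + snd p ^ 2 \<le> int D}"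
  proof
    fix p assume "p \<in> {- int s..int s} \<times> {- int s..int s}"
    then have "\<bar>fst p\<bar> \<le> \<bar>int s\<bar>" "\<bar>snd p\<bar> \<le> \<bar>int s\<bar>"
      by (auto simp: abs_le_iff)
    then have "(fst p)\<^sup>2 \<le> (int s)\<^sup>2" "(snd p)\<^sup>2 \<le> (int s)\<^sup>2"
      unfolding abs_le_square_iff .
    moreover have "2 * (int s)\<^sup>2 \<le> int D"
      using s2(1) by (metis of_nat_le_iff of_nat_mult of_nat_numeral of_nat_power)
    ultimately show "p \<in> {p. fst p ^ 2 + snd p ^ 2 \<le> int D}"
      by simp
  qed
  then have "card ({- int s..int s} \<times> {- int s..int s}) \<le> (\<Sum>d\<in>{0..D}. rsq d)"
    unfolding sum using finite_sum_of_two_squares by (rule card_mono[rotated])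
  moreover have "card ({- int s..int s} \<times> {- int s..int s}) = (2 * s + 1)\<^sup>2"
    by (simp add: card_cartesian_product power2_eq_square nat_add_distrib nat_mult_distrib)
  ultimately have "(2 * s + 1)\<^sup>2 \<le> (\<Sum>d\<in>{0..D}. rsq d)"
    by simp
  \<comment> \<open>The surplus 1 is harmless, since D lies strictly below the left-hand
    side.\<close>
  moreover have "2 * (s + 1)\<^sup>2 \<le> (2 * s + 1)\<^sup>2 + 1"
    by (simp add: power2_eq_square algebra_simps)
  ultimately show ?thesis
    using s2(2) by linarith
qed

text \<open>The last summand of the outer sum is already large enough. With K = \<kappa>(k,m) it
  provides 4nm \<le> R_0 for all n \<le> \<kappa>(k,m), the degree that the interpolation
  requires.\<close>

lemma Rfun_ge:
  assumes "m > 0"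
  shows "4 * m * K \<le> Rfun m (4 * m * K)"
proof -
  have "4 * m * K \<le> (\<Sum>d\<in>{0..4 * m * K}. rsq d)"
    by (rule sum_rsq_ge)
  also have "\<dots> \<le> (\<Sum>n\<in>{0..K}. \<Sum>d\<in>{0..4 * m * n}. rsq d)"
    by (rule member_le_sum[of K "{0..K}" "\<lambda>n. \<Sum>d\<in>{0..4 * m * n}. rsq d"]) auto
  finally show ?thesis
    using assms by (simp add: Rfun_def)
qed

section \<open>Interpolation over the values of the norm\<close>

lemma four_normK_nat:
  assumes "r \<in> dual_ball m n"
  obtains t where "4 * normK r = real t" "t \<le> 4 * n * m"
proof -
  have "r \<in> gauss_dual"
    using assms by (simp add: dual_ball_def)
  then obtain x y where xy: "4 * normK r = of_int (x\<^sup>2 + y\<^sup>2)"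
    by (rule gauss_dual_cases)
  then have t: "4 * normK r = real (nat (x\<^sup>2 + y\<^sup>2))"
    by simp
  moreover have "real (nat (x\<^sup>2 + y\<^sup>2)) \<le> real (4 * n * m)"
    using assms by (simp add: dual_ball_def flip: t)
  ultimately show thesis
    unfolding of_nat_le_iff by (rule that)
qed

text \<open>The polynomial P has as roots all integers from 0 to 4nm except 4 N(r0), so its degree
  is 4nm. Combining the power sums with the coefficients of P leaves only the circle through r0,
  where d is constant; the result is a nonzero multiple of d(r0).\<close>

lemma weighted_power_sums_imp_eq_0:
  fixes d :: "complex \<Rightarrow> complex"
  assumes power_sums: "\<And>j. j \<le> N \<Longrightarrow> (\<Sum>r\<in>dual_ball m n. d r * of_real (4 * normK r) ^ j) = 0"
    and N: "4 * n * m \<le> N"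
    and radial: "\<And>r r'. r \<in> dual_ball m n \<Longrightarrow> r' \<in> dual_ball m n \<Longrightarrow> normK r = normK r' \<Longrightarrow> d r = d r'"
    and r0: "r0 \<in> dual_ball m n"
  shows "d r0 = 0"
proof -
  obtain t0 where t0: "4 * normK r0 = real t0" "t0 \<le> 4 * n * m"
    using four_normK_nat[OF r0] by blast
  define P where "P = (\<Prod>u\<in>{0..4 * n * m} - {t0}. [:- of_nat u, 1 :: complex:])"
  have "degree P \<le> (\<Sum>u\<in>{0..4 * n * m} - {t0}. degree [:- of_nat u, 1 :: complex:])"
    unfolding P_def by (rule order_trans[OF degree_prod_sum_le]) (auto simp: o_def)
  also have "\<dots> \<le> N"
    using N t0(2) by simp
  finally have degP: "degree P \<le> N" .
  have P0: "poly P (of_nat t0) \<noteq> 0"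
    by (auto simp: P_def poly_prod)
  have P: "poly P (of_real (4 * normK r)) = (if normK r = normK r0 then poly P (of_nat t0) else 0)"
    if r: "r \<in> dual_ball m n" for r
  proof -
    obtain t where t: "4 * normK r = real t" "t \<le> 4 * n * m"
      using four_normK_nat[OF r] by blast
    have "normK r = normK r0 \<longleftrightarrow> t = t0"
      using t t0 by linarith
    then show ?thesis
      unfolding t(1) using t(2) by (auto simp: P_def poly_prod intro!: prod_zero bexI[of _ t])
  qed
  let ?A = "{r \<in> dual_ball m n. normK r = normK r0}"
  have "0 = (\<Sum>j\<le>degree P. coeff P j * (\<Sum>r\<in>dual_ball m n. d r * of_real (4 * normK r) ^ j))"
    using power_sums degP by simp
  also have "\<dots> = (\<Sum>r\<in>dual_ball m n. d r * poly P (of_real (4 * normK r)))"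
    unfolding poly_altdef sum_distrib_left by (subst sum.swap) (simp add: mult_ac)
  also have "\<dots> = (\<Sum>r\<in>?A. d r * poly P (of_real (4 * normK r)))"
    by (rule sum.mono_neutral_right) (auto simp: finite_dual_ball P simp del: of_real_mult)
  also have "\<dots> = (\<Sum>r\<in>?A. d r0 * poly P (of_nat t0))"
  proof (rule sum.cong)
    fix r assume "r \<in> ?A"
    then show "d r * poly P (of_real (4 * normK r)) = d r0 * poly P (of_nat t0)"
      using P[of r] radial[of r r0] r0 by auto
  qed auto
  also have "\<dots> = of_nat (card ?A) * (d r0 * poly P (of_nat t0))"
    by simp
  finally have "of_nat (card ?A) * (d r0 * poly P (of_nat t0)) = 0"
    by simp
  moreover have "card ?A \<noteq> 0"
    using r0 finite_dual_ball[of m n] by auto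
  ultimately show ?thesis
    using P0 by simp
qed

lemma diagonal_coeffs_determine_radial_coeffs:
  assumes "fourier_expansion m c1 f1" "fourier_expansion m c2 f2"
    and eq: "\<And>j. j \<le> N \<Longrightarrow> fourier_expansion.diagonal_coeff m c1 n j = fourier_expansion.diagonal_coeff m c2 n j"
    and N: "4 * n * m \<le> N"
    and radial1: "\<And>r r'. r \<in> dual_ball m n \<Longrightarrow> r' \<in> dual_ball m n \<Longrightarrow> normK r = normK r' \<Longrightarrow> c1 (n, r) = c1 (n, r')"
    and radial2: "\<And>r r'. r \<in> dual_ball m n \<Longrightarrow> r' \<in> dual_ball m n \<Longrightarrow> normK r = normK r' \<Longrightarrow> c2 (n, r) = c2 (n, r')"
    and r: "r \<in> dual_ball m n"
  shows "c1 (n, r) = c2 (n, r)"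
proof -
  interpret F1: fourier_expansion m c1 f1 by fact
  interpret F2: fourier_expansion m c2 f2 by fact
  have "c1 (n, r) - c2 (n, r) = 0"
  proof (rule weighted_power_sums_imp_eq_0[where d = "\<lambda>r. c1 (n, r) - c2 (n, r)", OF _ N])
    fix j assume "j \<le> N"
    then have "0 = F1.diagonal_coeff n j - F2.diagonal_coeff n j"
      using eq by simp
    \<comment> \<open>Splitting - 4 \<pi>^2 N(r) as - \<pi>^2 times 4 N(r) isolates a nonzero factor
      independent of r, which is cancelled at the end.\<close>
    also have "\<dots> = (\<Sum>r\<in>dual_ball m n. (- of_real (pi\<^sup>2)) ^ j / (fact j)\<^sup>2 * ((c1 (n, r) - c2 (n, r)) * of_real (4 * normK r) ^ j))"
      unfolding F1.diagonal_coeff_def F2.diagonal_coeff_def sum_subtractf[symmetric]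
    proof (rule sum.cong[OF refl])
      fix r
      have "- 4 * of_real (pi\<^sup>2 * normK r) = - of_real (pi\<^sup>2) * (of_real (4 * normK r) :: complex)"
        by simp
      then have "(- 4 * of_real (pi\<^sup>2 * normK r)) ^ j = (- of_real (pi\<^sup>2)) ^ j * (of_real (4 * normK r) :: complex) ^ j"
        by (simp only: power_mult_distrib)
      then show "c1 (n, r) * (- 4 * of_real (pi\<^sup>2 * normK r)) ^ j / (fact j)\<^sup>2 -
          c2 (n, r) * (- 4 * of_real (pi\<^sup>2 * normK r)) ^ j / (fact j)\<^sup>2 =
          (- of_real (pi\<^sup>2)) ^ j / (fact j)\<^sup>2 * ((c1 (n, r) - c2 (n, r)) * of_real (4 * normK r) ^ j)"
        by (simp only:) (simp only: left_diff_distrib right_diff_distrib diff_divide_distrib mult_ac times_divide_eq_right times_divide_eq_left)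
    qed
    finally show "(\<Sum>r\<in>dual_ball m n. (c1 (n, r) - c2 (n, r)) * of_real (4 * normK r) ^ j) = 0"
      unfolding sum_distrib_left[symmetric] by simp
  next
    fix r r' assume "r \<in> dual_ball m n" "r' \<in> dual_ball m n" "normK r = normK r'"
    from radial1[OF this] radial2[OF this] show "c1 (n, r) - c2 (n, r) = c1 (n, r') - c2 (n, r')"
      by (rule arg_cong2)
  qed (rule r)
  then show ?thesis
    by simp
qed

section \<open>The maximum principle for exponential series\<close>

text \<open>A Phragmen-Lindelof argument. The divisor \<open>D \<delta>\<close> has real part at
  least 1 on the half plane and grows linearly, so the quotient is at most B on the line and on a
  large arc; then \<delta> tends to 0.\<close>

lemma half_plane_maximum_principle:
  assumes hol: "G holomorphic_on uhp" and y0: "y0 > 0"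
    and bounded: "\<And>\<tau>. Im \<tau> \<ge> y0 \<Longrightarrow> norm (G \<tau>) \<le> C"
    and line: "\<And>\<tau>. Im \<tau> = y0 \<Longrightarrow> norm (G \<tau>) \<le> B"
    and B: "B > 0" and w: "Im w \<ge> y0"
  shows "norm (G w) \<le> B"
proof -
  define p where "p = \<i> * of_real y0"
  define D where "D \<delta> \<tau> = 1 - \<i> * of_real \<delta> * (\<tau> - p)" for \<delta> :: real and \<tau> :: complex
  have "C \<ge> 0"
    using bounded[of p] norm_ge_zero[of "G p"] by (simp add: p_def del: norm_ge_zero)
  have Re_D: "Re (D \<delta> \<tau>) = 1 + \<delta> * (Im \<tau> - y0)" for \<delta> \<tau>
    by (simp add: D_def p_def algebra_simps)
  have D1: "norm (D \<delta> \<tau>) \<ge> 1" if "\<delta> > 0" "Im \<tau> \<ge> y0" for \<delta> \<tau>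
  proof -
    have "1 \<le> Re (D \<delta> \<tau>)"
      using that by (simp add: Re_D)
    also have "\<dots> \<le> norm (D \<delta> \<tau>)"
      by (rule complex_Re_le_cmod)
    finally show ?thesis .
  qed
  have damped: "norm (G w) \<le> B * norm (D \<delta> w)" if \<delta>: "\<delta> > 0" for \<delta>
  proof -
    \<comment> \<open>Large enough that w lies in the disc and that \<delta> r \<ge> C / B + 1,
      which makes \<open>D \<delta>\<close> at least C / B in modulus on the arc.\<close>
    define r where "r = norm (w - p) + (C / B + 1) / \<delta> + 1"
    have Q: "(C / B + 1) / \<delta> > 0" "\<delta> * ((C / B + 1) / \<delta>) = C / B + 1"
      using \<delta> B \<open>C \<ge> 0\<close> by (auto intro!: divide_pos_pos add_nonneg_pos)
    have r: "r > norm (w - p)" "\<delta> * r \<ge> C / B + 1" "r > 0"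
      unfolding r_def distrib_left Q(2) using Q(1) \<delta> by (auto simp: add_pos_nonneg add_nonneg_pos)
    define S where "S = {\<tau>. Im \<tau> \<ge> y0} \<inter> ball p r"
    have "norm (G w / D \<delta> w) \<le> B"
    proof (rule maximum_modulus_frontier[of "\<lambda>\<tau>. G \<tau> / D \<delta> \<tau>" S])
      have sub: "closure S \<subseteq> {\<tau>. Im \<tau> \<ge> y0}"
        unfolding S_def by (rule closure_minimal) (auto simp: closed_halfspace_Im_ge)
      have ne: "D \<delta> \<tau> \<noteq> 0" if "Im \<tau> \<ge> y0" for \<tau>
        using D1[OF \<delta> that] by auto
      have "{\<tau>. Im \<tau> \<ge> y0} \<subseteq> uhp"
        using y0 by (auto simp: uhp_def)
      then have "G holomorphic_on {\<tau>. Im \<tau> \<ge> y0}"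
        using hol holomorphic_on_subset by blast
      then have hol': "(\<lambda>\<tau>. G \<tau> / D \<delta> \<tau>) holomorphic_on {\<tau>. Im \<tau> \<ge> y0}"
        unfolding D_def[abs_def]
        by (intro holomorphic_intros) (use ne in \<open>auto simp: D_def\<close>)
      show "(\<lambda>\<tau>. G \<tau> / D \<delta> \<tau>) holomorphic_on interior S"
        using hol' by (rule holomorphic_on_subset) (use sub interior_subset[of S] in \<open>auto simp: S_def\<close>)
      show "continuous_on (closure S) (\<lambda>\<tau>. G \<tau> / D \<delta> \<tau>)"
        using holomorphic_on_imp_continuous_on[OF hol'] sub by (rule continuous_on_subset)
      show "bounded S"
        unfolding S_def by (intro bounded_Int) auto
      show "w \<in> S"
        using w r(1) by (simp add: S_def dist_norm norm_minus_commute)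
      fix \<tau> assume \<tau>: "\<tau> \<in> frontier S"
      then have Im_\<tau>: "Im \<tau> \<ge> y0"
        using sub by (auto simp: frontier_def)
      have "\<tau> \<in> frontier {\<tau>. Im \<tau> \<ge> y0} \<union> frontier (ball p r)"
        using \<tau> frontier_Int_subset unfolding S_def by blast
      then consider "Im \<tau> = y0" | "norm (\<tau> - p) = r"
      proof
        assume "\<tau> \<in> frontier {\<tau>. Im \<tau> \<ge> y0}"
        moreover have "\<tau> \<in> interior {\<tau>. Im \<tau> \<ge> y0}" if "Im \<tau> > y0"
          by (rule interiorI[of "{\<tau>. Im \<tau> > y0}"]) (use that in \<open>auto simp: open_halfspace_Im_gt\<close>)
        ultimately have "Im \<tau> = y0"
          using Im_\<tau> by (force simp: frontier_def)
        then show thesis by (rule that)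
      next
        assume "\<tau> \<in> frontier (ball p r)"
        then show thesis
          using r(3) by (intro that(2)) (simp add: dist_norm norm_minus_commute)
      qed
      then show "norm (G \<tau> / D \<delta> \<tau>) \<le> B"
      proof cases
        case 1
        then have "norm (G \<tau>) / norm (D \<delta> \<tau>) \<le> B / 1"
          using line D1[OF \<delta> Im_\<tau>] B by (intro frac_le) auto
        then show ?thesis by (simp add: norm_divide)
      next
        case 2
        have "norm (\<i> * of_real \<delta> * (\<tau> - p)) \<le> norm (1 - D \<delta> \<tau>)"
          by (simp add: D_def)
        also have "\<dots> \<le> 1 + norm (D \<delta> \<tau>)"
          using norm_triangle_ineq4[of 1 "D \<delta> \<tau>"] by simp
        finally have "C / B \<le> norm (D \<delta> \<tau>)"
          using r(2) \<delta> 2 by (simp add: norm_mult)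
        then have "C \<le> B * norm (D \<delta> \<tau>)"
          using B by (simp add: field_simps)
        then have "norm (G \<tau>) \<le> B * norm (D \<delta> \<tau>)"
          using bounded[OF Im_\<tau>] by linarith
        then show ?thesis
          using D1[OF \<delta> Im_\<tau>] by (auto simp: norm_divide divide_simps)
      qed
    qed
    then show ?thesis
      using D1[OF \<delta> w] by (auto simp: norm_divide divide_simps split: if_splits)
  qed
  have "((\<lambda>\<delta>. B * norm (D \<delta> w)) \<longlongrightarrow> B * norm (D 0 w)) (at_right 0)"
    unfolding D_def by (intro tendsto_intros)
  moreover have "\<forall>\<^sub>F \<delta> in at_right 0. norm (G w) \<le> B * norm (D \<delta> w)"
    using damped by (auto simp: eventually_at_filter)
  ultimately have "norm (G w) \<le> B * norm (D 0 w)"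
    by (intro tendsto_lowerbound) auto
  then show ?thesis
    by (simp add: D_def)
qed

text \<open>The exponents are real, so G need not be a function of q and the maximum principle is
  applied on a half plane instead of a disc. Nonnegative exponents make every term decrease with the
  height: the absolute series at a lower height is a majorant, which gives both holomorphy and
  boundedness.\<close>

lemma exponential_series_maximum_principle:
  fixes b :: "'i \<Rightarrow> complex" and E :: "'i \<Rightarrow> real"
  assumes sum: "\<And>\<tau>. \<tau> \<in> uhp \<Longrightarrow> ((\<lambda>p. b p * e (of_real (E p) * \<tau>)) has_sum G \<tau>) I"
    and nonneg: "\<And>p. p \<in> I \<Longrightarrow> b p \<noteq> 0 \<Longrightarrow> E p \<ge> 0"
    and y0: "y0 > 0" and line: "\<And>\<tau>. Im \<tau> = y0 \<Longrightarrow> norm (G \<tau>) \<le> B"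
    and B: "B > 0" and w: "Im w \<ge> y0"
  shows "norm (G w) \<le> B"
proof -
  define M where "M y p = norm (b p) * exp (- 2 * pi * E p * y)" for y p
  have term_le: "norm (b p * e (of_real (E p) * \<tau>)) \<le> M y p" if "p \<in> I" "Im \<tau> \<ge> y" for p \<tau> y
  proof (cases "b p = 0")
    case False
    then have "E p * y \<le> E p * Im \<tau>"
      using nonneg[OF that(1)] that(2) by (intro mult_left_mono) auto
    then show ?thesis
      by (simp add: M_def norm_mult norm_e mult_left_mono)
  qed (simp add: M_def)
  have M: "M y summable_on I" if "y > 0" for y
  proof -
    have "(\<lambda>p. norm (b p * e (of_real (E p) * (\<i> * of_real y)))) summable_on I"
      using has_sum_imp_summable[OF sum[of "\<i> * of_real y"]] that
      by (subst summable_on_iff_abs_summable_on_complex[symmetric]) (simp add: uhp_def)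
    then show ?thesis
      by (simp add: M_def[abs_def] norm_mult norm_e mult_ac)
  qed
  have hol: "G holomorphic_on uhp"
  proof -
    have "G field_differentiable (at z)" if z: "z \<in> uhp" for z
    proof -
      define \<rho> where "\<rho> = Im z / 2"
      have \<rho>: "\<rho> > 0"
        using z by (simp add: \<rho>_def uhp_def)
      have Im_ge: "Im \<tau> \<ge> \<rho>" if "\<tau> \<in> cball z \<rho>" for \<tau>
      proof -
        have "\<bar>Im (z - \<tau>)\<bar> \<le> \<rho>"
          using that abs_Im_le_cmod[of "z - \<tau>"] by (auto simp: dist_norm)
        then show ?thesis
          unfolding \<rho>_def minus_complex.sel by linarith
      qed
      have lim: "uniform_limit (cball z \<rho>) (\<lambda>X \<tau>. \<Sum>p\<in>X. b p * e (of_real (E p) * \<tau>))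
          (\<lambda>\<tau>. \<Sum>\<^sub>\<infinity>p\<in>I. b p * e (of_real (E p) * \<tau>)) (finite_subsets_at_top I)"
        by (rule Weierstrass_m_test_general[of _ _ _ "M \<rho>"]) (use term_le Im_ge M \<rho> in auto)
      have "(\<lambda>\<tau>. \<Sum>p\<in>X. b p * e (of_real (E p) * \<tau>)) holomorphic_on A" for X A
        unfolding e_def by (intro holomorphic_intros)
      then have "\<forall>\<^sub>F X in finite_subsets_at_top I.
          continuous_on (cball z \<rho>) (\<lambda>\<tau>. \<Sum>p\<in>X. b p * e (of_real (E p) * \<tau>)) \<and>
          (\<lambda>\<tau>. \<Sum>p\<in>X. b p * e (of_real (E p) * \<tau>)) holomorphic_on ball z \<rho>"
        by (intro always_eventually allI conjI holomorphic_on_imp_continuous_on)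
      from holomorphic_uniform_limit[OF this lim]
      have "(\<lambda>\<tau>. \<Sum>\<^sub>\<infinity>p\<in>I. b p * e (of_real (E p) * \<tau>)) holomorphic_on ball z \<rho>"
        by auto
      also have "?this \<longleftrightarrow> G holomorphic_on ball z \<rho>"
      proof (rule holomorphic_cong[OF refl])
        fix \<tau> assume "\<tau> \<in> ball z \<rho>"
        then have "\<tau> \<in> uhp"
          using Im_ge[of \<tau>] \<rho> by (auto simp: uhp_def)
        from sum[OF this] show "(\<Sum>\<^sub>\<infinity>p\<in>I. b p * e (of_real (E p) * \<tau>)) = G \<tau>"
          by (rule infsumI)
      qed
      finally show ?thesis
        using \<rho> by (intro holomorphic_on_imp_differentiable_at[of _ "ball z \<rho>"]) auto
    qed
    then show ?thesis
      by (auto simp: holomorphic_on_def intro: field_differentiable_at_within)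
  qed
  have bounded: "norm (G \<tau>) \<le> infsum (M y0) I" if "Im \<tau> \<ge> y0" for \<tau>
  proof (rule norm_infsum_le)
    show "((\<lambda>p. b p * e (of_real (E p) * \<tau>)) has_sum G \<tau>) I"
      using that y0 by (intro sum) (simp add: uhp_def)
    show "(M y0 has_sum infsum (M y0) I) I"
      using M[OF y0] by simp
  qed (use term_le that in auto)
  show ?thesis
    using half_plane_maximum_principle[OF hol y0 bounded line B w] .
qed

text \<open>Completing the square and N(r) \<le> nm cost at most n/2 + 2m|l|^2, which leaves n/2 -
  m/2 \<ge> (m^2 k - m)/4. For m \<ge> 1 and k \<ge> 4 this is at least 3k/16, with equality in the
  last step at m = 1, k = 4.\<close>

lemma exponent_lower_bound:
  fixes r l :: complex
  assumes r: "normK r \<le> real n * real m" and l: "(norm l)\<^sup>2 \<le> 1 / 2"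
    and n: "real n \<ge> (real m)\<^sup>2 * real k / 2 + real m / 2" and m: "m \<ge> 1" and k: "k \<ge> 4"
  shows "real n + 2 * Re (r * l) + real m * (norm l)\<^sup>2 \<ge> 3 * real k / 16"
proof -
  have m0: "real m > 0"
    using m by simp
  have "- (norm r * norm l) \<le> Re (r * l)"
    using complex_Re_le_cmod[of "- (r * l)"] by (simp add: norm_mult)
  moreover have "2 * (norm r * norm l) \<le> (norm r)\<^sup>2 / (2 * real m) + 2 * real m * (norm l)\<^sup>2"
  proof -
    have "0 \<le> (norm r - 2 * real m * norm l)\<^sup>2 / (2 * real m)"
      using m0 by simp
    also have "\<dots> = (norm r)\<^sup>2 / (2 * real m) + 2 * real m * (norm l)\<^sup>2 - 2 * (norm r * norm l)"
      using m0 by (simp add: field_simps power2_eq_square)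
    finally show ?thesis by simp
  qed
  moreover have "(norm r)\<^sup>2 / (2 * real m) \<le> real n / 2"
    using r m0 by (simp add: normK_eq field_simps)
  moreover have "real m * (norm l)\<^sup>2 \<le> real m / 2"
    using mult_left_mono[OF l, of "real m"] by simp
  ultimately have "real n + 2 * Re (r * l) + real m * (norm l)\<^sup>2 \<ge> real n / 2 - real m / 2"
    by linarith
  moreover have "(real m)\<^sup>2 * real k - real m \<ge> 3 * real k / 4"
  proof -
    have "1 * (3 * real k / 4) \<le> real m * (real k - 1)"
      using m k by (intro mult_mono) auto
    also have "\<dots> \<le> (real m)\<^sup>2 * real k - real m"
    proof -
      have "real m * real k \<le> (real m)\<^sup>2 * real k"
        using m by (intro mult_right_mono) (auto simp: power2_eq_square)
      then show ?thesis by (simp add: right_diff_distrib)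
    qed
    finally show ?thesis by simp
  qed
  ultimately show ?thesis
    using n by (simp add: field_simps)
qed

lemma complex_round_gauss_int:
  obtains l where "l \<in> gauss_ints" "(norm (z + l))\<^sup>2 \<le> 1 / 2"
proof
  let ?l = "of_int (- round (Re z)) + \<i> * of_int (- round (Im z)) :: complex"
  show "?l \<in> gauss_ints"
    unfolding gauss_ints_def by blast
  have "\<bar>Re (z + ?l)\<bar> \<le> \<bar>1 / 2\<bar>" "\<bar>Im (z + ?l)\<bar> \<le> \<bar>1 / 2\<bar>"
    using of_int_round_abs_le[of "Re z"] of_int_round_abs_le[of "Im z"] by (auto simp: abs_minus_commute)
  then have "(Re (z + ?l))\<^sup>2 \<le> (1 / 2)\<^sup>2" "(Im (z + ?l))\<^sup>2 \<le> (1 / 2)\<^sup>2"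
    unfolding abs_le_square_iff .
  then show "(norm (z + ?l))\<^sup>2 \<le> 1 / 2"
    unfolding cmod_power2 by (simp add: power2_eq_square)
qed

section \<open>The invariant norm\<close>

text \<open>Only the transformations that reduction theory applies are recorded: integral
  translations and inversion of \<tau>, and shifts of (z1, z2) by Gaussian multiples of \<tau>. The
  assumption \<open>vanishing\<close> states the bound on n that the exponent estimate
  consumes.\<close>

locale jacobi_form_of_high_order = fourier_expansion +
  fixes k :: nat
  assumes k: "k \<ge> 4" and m: "m \<ge> 1"
    and translate: "\<tau> \<in> uhp \<Longrightarrow> f (\<tau> + of_int b) z1 z2 = f \<tau> z1 z2"
    and invert: "\<tau> \<in> uhp \<Longrightarrow> f (- 1 / \<tau>) (z1 / \<tau>) (z2 / \<tau>) = \<tau> ^ k * e (of_nat m * z1 * z2 / \<tau>) * f \<tau> z1 z2"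
    and lattice: "\<tau> \<in> uhp \<Longrightarrow> l \<in> gauss_ints \<Longrightarrow>
      e (of_nat m * (of_real (normK l) * \<tau> + cnj l * z1 + l * z2)) * f \<tau> (z1 + l * \<tau>) (z2 + cnj l * \<tau>) = f \<tau> z1 z2"
    and vanishing: "(n, r) \<in> fourier_index m \<Longrightarrow> c (n, r) \<noteq> 0 \<Longrightarrow> real n \<ge> (real m)\<^sup>2 * real k / 2 + real m / 2"
begin

text \<open>The function W of the overview; \<open>sqrt (Im \<tau>) ^ k\<close> is y^(k/2). The
  Gaussian factor is what balances the exponential automorphy factors.\<close>

definition petersson :: "complex \<Rightarrow> complex \<Rightarrow> complex \<Rightarrow> real" where
  "petersson \<tau> z1 z2 = sqrt (Im \<tau>) ^ k * exp (- pi * real m * (norm (z1 - cnj z2))\<^sup>2 / (2 * Im \<tau>)) * norm (f \<tau> z1 z2)"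

lemma petersson_translate:
  assumes "\<tau> \<in> uhp"
  shows "petersson (\<tau> + of_int b) z1 z2 = petersson \<tau> z1 z2"
  using translate[OF assms] by (simp add: petersson_def)

lemma petersson_invert:
  assumes \<tau>: "\<tau> \<in> uhp"
  shows "petersson (- 1 / \<tau>) (z1 / \<tau>) (z2 / \<tau>) = petersson \<tau> z1 z2"
proof -
  have \<tau>0: "\<tau> \<noteq> 0" "norm \<tau> > 0" and y: "Im \<tau> > 0"
    using \<tau> by (auto simp: uhp_def)
  have Im': "Im (- 1 / \<tau>) = Im \<tau> / (norm \<tau>)\<^sup>2"
    using \<tau>0 by (simp add: Im_divide cmod_power2)
  define u where "u = z1 / \<tau>"
  define v where "v = z2 / \<tau>"
  have z: "z1 = u * \<tau>" "z2 = v * \<tau>"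
    using \<tau>0 by (simp_all add: u_def v_def)
  \<comment> \<open>The difference of the two squared distances is 2 Re (u v \<tau>
    (\<open>cnj \<tau>\<close> - \<tau>)), so the Gaussian factor changes exactly by the modulus of
    the automorphy factor.\<close>
  have id: "(norm (u * \<tau> - cnj (v * \<tau>)))\<^sup>2 = (norm \<tau>)\<^sup>2 * (norm (u - cnj v))\<^sup>2 + 4 * Im \<tau> * Im (u * v * \<tau>)"
    unfolding cmod_power2 by (simp add: power2_eq_square algebra_simps)
  have "- pi * real m * (norm (u - cnj v))\<^sup>2 / (2 * (Im \<tau> / (norm \<tau>)\<^sup>2)) + - 2 * pi * Im (of_nat m * (u * v * \<tau>)) =
      - pi * real m / (2 * Im \<tau>) * ((norm \<tau>)\<^sup>2 * (norm (u - cnj v))\<^sup>2 + 4 * Im \<tau> * Im (u * v * \<tau>))"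
    using y \<tau>0 by (simp add: field_simps)
  also have "\<dots> = - pi * real m * (norm (u * \<tau> - cnj (v * \<tau>)))\<^sup>2 / (2 * Im \<tau>)"
    unfolding id by simp
  finally have expo: "- pi * real m * (norm (u - cnj v))\<^sup>2 / (2 * (Im \<tau> / (norm \<tau>)\<^sup>2)) + - 2 * pi * Im (of_nat m * (u * v * \<tau>)) =
      - pi * real m * (norm (u * \<tau> - cnj (v * \<tau>)))\<^sup>2 / (2 * Im \<tau>)" .
  have f: "norm (f (- 1 / \<tau>) u v) = norm \<tau> ^ k * exp (- 2 * pi * Im (of_nat m * (u * v * \<tau>))) * norm (f \<tau> z1 z2)"
    unfolding u_def v_def invert[OF \<tau>] norm_mult norm_e norm_power
    using \<tau>0 by (simp add: mult_ac)
  have "petersson (- 1 / \<tau>) u v = (sqrt (Im \<tau>) / norm \<tau>) ^ k *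
      exp (- pi * real m * (norm (u - cnj v))\<^sup>2 / (2 * (Im \<tau> / (norm \<tau>)\<^sup>2))) *
      (norm \<tau> ^ k * exp (- 2 * pi * Im (of_nat m * (u * v * \<tau>))) * norm (f \<tau> z1 z2))"
    unfolding petersson_def Im' f using \<tau>0 by (simp add: real_sqrt_divide)
  also have "\<dots> = sqrt (Im \<tau>) ^ k * (exp (- pi * real m * (norm (u - cnj v))\<^sup>2 / (2 * (Im \<tau> / (norm \<tau>)\<^sup>2))) *
      exp (- 2 * pi * Im (of_nat m * (u * v * \<tau>)))) * norm (f \<tau> z1 z2)"
    using \<tau>0 by (simp add: power_divide)
  also have "\<dots> = petersson \<tau> z1 z2"
    unfolding petersson_def exp_add[symmetric] expo z ..
  finally show ?thesis
    by (simp add: u_def v_def)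
qed

lemma petersson_lattice:
  assumes \<tau>: "\<tau> \<in> uhp" and l: "l \<in> gauss_ints"
  shows "petersson \<tau> (z1 + l * \<tau>) (z2 + cnj l * \<tau>) = petersson \<tau> z1 z2"
proof -
  have y: "Im \<tau> > 0"
    using \<tau> by (simp add: uhp_def)
  define A where "A = Im (of_real (normK l) * \<tau> + cnj l * z1 + l * z2)"
  \<comment> \<open>As for the inversion: the squared distance grows by 4 y A, and exp(- 2 \<pi> m
    A) is the modulus of the lattice multiplier.\<close>
  have id: "(norm (z1 + l * \<tau> - cnj (z2 + cnj l * \<tau>)))\<^sup>2 = (norm (z1 - cnj z2))\<^sup>2 + 4 * Im \<tau> * A"
    unfolding cmod_power2 A_def normK_eq by (simp add: power2_eq_square algebra_simps)
  have "norm (f \<tau> z1 z2) = exp (- 2 * pi * (real m * A)) * norm (f \<tau> (z1 + l * \<tau>) (z2 + cnj l * \<tau>))"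
    unfolding lattice[OF \<tau> l, of z1 z2, symmetric] norm_mult norm_e A_def by simp
  then have "petersson \<tau> z1 z2 = sqrt (Im \<tau>) ^ k * (exp (- pi * real m * (norm (z1 - cnj z2))\<^sup>2 / (2 * Im \<tau>)) *
      exp (- 2 * pi * (real m * A))) * norm (f \<tau> (z1 + l * \<tau>) (z2 + cnj l * \<tau>))"
    by (simp add: petersson_def)
  also have "exp (- pi * real m * (norm (z1 - cnj z2))\<^sup>2 / (2 * Im \<tau>)) * exp (- 2 * pi * (real m * A)) =
      exp (- pi * real m * (norm (z1 + l * \<tau> - cnj (z2 + cnj l * \<tau>)))\<^sup>2 / (2 * Im \<tau>))"
    unfolding exp_add[symmetric] id using y by (simp add: field_simps)
  finally show ?thesis
    unfolding petersson_def[of \<tau> "z1 + l * \<tau>"] by (rule sym)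
qed

text \<open>On this slice z1 - \<open>cnj z2\<close> equals 2 i y l, so the Gaussian factor is the
  modulus of the holomorphic function e(m |l|^2 \<tau>). The shift by 3k/16 removes the guaranteed
  decay, leaving exponents that are just nonnegative.\<close>

definition slice :: "complex \<Rightarrow> complex \<Rightarrow> complex \<Rightarrow> complex" where
  "slice l u \<tau> = e (of_real (real m * (norm l)\<^sup>2 - 3 * real k / 16) * \<tau>) * f \<tau> (l * \<tau> + u) (cnj l * \<tau> + cnj u)"

lemma petersson_eq_slice:
  assumes \<tau>: "\<tau> \<in> uhp"
  shows "petersson \<tau> (l * \<tau> + u) (cnj l * \<tau> + cnj u) =
    (sqrt (Im \<tau>) * exp (- 3 * pi / 8 * Im \<tau>)) ^ k * norm (slice l u \<tau>)"
proof -
  have y: "Im \<tau> > 0"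
    using \<tau> by (simp add: uhp_def)
  have id: "(norm (l * \<tau> + u - cnj (cnj l * \<tau> + cnj u)))\<^sup>2 = 4 * (Im \<tau>)\<^sup>2 * (norm l)\<^sup>2"
    unfolding cmod_power2 by (simp add: power2_eq_square algebra_simps)
  have "exp (- 3 * pi / 8 * Im \<tau>) ^ k * exp (- 2 * pi * Im (of_real (real m * (norm l)\<^sup>2 - 3 * real k / 16) * \<tau>)) =
      exp (- pi * real m * (norm (l * \<tau> + u - cnj (cnj l * \<tau> + cnj u)))\<^sup>2 / (2 * Im \<tau>))"
    unfolding id exp_of_nat_mult[symmetric] exp_add[symmetric]
    using y by (simp add: field_simps power2_eq_square)
  then show ?thesis
    unfolding petersson_def slice_def norm_mult norm_e power_mult_distrib
    by (metis (no_types, lifting) mult.assoc)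
qed

definition slice_coeff :: "complex \<Rightarrow> nat \<times> complex \<Rightarrow> complex" where
  "slice_coeff u = (\<lambda>(n, r). c (n, r) * e (r * u + cnj r * cnj u))"

definition slice_exponent :: "complex \<Rightarrow> nat \<times> complex \<Rightarrow> real" where
  "slice_exponent l = (\<lambda>(n, r). real n + 2 * Re (r * l) + real m * (norm l)\<^sup>2 - 3 * real k / 16)"

lemma norm_slice_coeff: "norm (slice_coeff u p) = norm (c p)"
  by (cases p) (simp add: slice_coeff_def norm_mult norm_e)

lemma slice_has_sum:
  assumes \<tau>: "\<tau> \<in> uhp"
  shows "((\<lambda>p. slice_coeff u p * e (of_real (slice_exponent l p) * \<tau>)) has_sum slice l u \<tau>) (fourier_index m)"
proof -
  let ?e = "e (of_real (real m * (norm l)\<^sup>2 - 3 * real k / 16) * \<tau>)"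
  have "((\<lambda>p. ?e * (case p of (n, r) \<Rightarrow> c (n, r) * e (of_nat n * \<tau> + r * (l * \<tau> + u) + cnj r * (cnj l * \<tau> + cnj u))))
      has_sum slice l u \<tau>) (fourier_index m)"
    unfolding slice_def by (intro has_sum_cmult_right expansion \<tau>)
  also have "(\<lambda>p. ?e * (case p of (n, r) \<Rightarrow> c (n, r) * e (of_nat n * \<tau> + r * (l * \<tau> + u) + cnj r * (cnj l * \<tau> + cnj u)))) =
      (\<lambda>p. slice_coeff u p * e (of_real (slice_exponent l p) * \<tau>))"
  proof (rule ext)
    fix p :: "nat \<times> complex"
    obtain n r where p: "p = (n, r)" by fastforce
    have Re: "complex_of_real (2 * Re (r * l)) = r * l + cnj r * cnj l"
      by (simp add: complex_eq_iff)
    have "of_real (real m * (norm l)\<^sup>2 - 3 * real k / 16) * \<tau> + (of_nat n * \<tau> + r * (l * \<tau> + u) + cnj r * (cnj l * \<tau> + cnj u)) =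
        (r * u + cnj r * cnj u) + of_real (real n + 2 * Re (r * l) + real m * (norm l)\<^sup>2 - 3 * real k / 16) * \<tau>"
      unfolding of_real_add of_real_diff Re by (simp add: algebra_simps)
    then show "?e * (case p of (n, r) \<Rightarrow> c (n, r) * e (of_nat n * \<tau> + r * (l * \<tau> + u) + cnj r * (cnj l * \<tau> + cnj u))) =
        slice_coeff u p * e (of_real (slice_exponent l p) * \<tau>)"
      unfolding p slice_coeff_def slice_exponent_def prod.case
      by (metis (no_types, lifting) e_add mult.assoc mult.left_commute)
  qed
  finally show ?thesis .
qed

lemma slice_exponent_nonneg:
  assumes l: "(norm l)\<^sup>2 \<le> 1 / 2" and p: "p \<in> fourier_index m" "slice_coeff u p \<noteq> 0"
  shows "slice_exponent l p \<ge> 0"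
proof -
  obtain n r where nr: "p = (n, r)" by fastforce
  have "c (n, r) \<noteq> 0"
    using p(2) by (auto simp: nr slice_coeff_def)
  then have "real n \<ge> (real m)\<^sup>2 * real k / 2 + real m / 2"
    using vanishing p(1) by (simp add: nr)
  from exponent_lower_bound[OF _ l this m k, of r] show ?thesis
    using p(1) by (simp add: nr slice_exponent_def fourier_index_def)
qed

text \<open>At height at least 3/4 a lattice shift brings l into the unit square around 0. Below
  3/4, translating to |Re| \<le> 1/2 gives |t|^2 \<le> 1/4 + 9/16 = 13/16, so an inversion raises
  the height by a factor of at least 16/13 and finitely many of them suffice.\<close>

lemma petersson_le_by_reduction:
  assumes B: "\<And>\<tau> l u. Im \<tau> \<ge> 3 / 4 \<Longrightarrow> (norm l)\<^sup>2 \<le> 1 / 2 \<Longrightarrow>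
      petersson \<tau> (l * \<tau> + u) (cnj l * \<tau> + cnj u) \<le> B"
    and \<tau>: "\<tau> \<in> uhp"
  shows "petersson \<tau> z1 z2 \<le> B"
proof -
  have high: "petersson \<tau> z1 z2 \<le> B" if y: "Im \<tau> \<ge> 3 / 4" for \<tau> z1 z2
  proof -
    have \<tau>: "\<tau> \<in> uhp"
      using y by (simp add: uhp_def)
    \<comment> \<open>The slice parameter of (z1, z2), determined by h (\<tau> -
      \<open>cnj \<tau>\<close>) = z1 - \<open>cnj z2\<close>.\<close>
    define h where "h = (z1 - cnj z2) / (2 * \<i> * of_real (Im \<tau>))"
    obtain l where l: "l \<in> gauss_ints" "(norm (h + l))\<^sup>2 \<le> 1 / 2"
      by (rule complex_round_gauss_int)
    have h: "h * (\<tau> - cnj \<tau>) = z1 - cnj z2"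
      using y by (simp add: h_def complex_diff_cnj mult_ac)
    define u where "u = z1 - h * \<tau>"
    have "cnj h * (cnj \<tau> - \<tau>) = cnj z1 - z2"
      using arg_cong[OF h, of cnj] by simp
    then have z: "z1 + l * \<tau> = (h + l) * \<tau> + u" "z2 + cnj l * \<tau> = cnj (h + l) * \<tau> + cnj u"
      by (simp_all add: u_def algebra_simps)
    have "petersson \<tau> (z1 + l * \<tau>) (z2 + cnj l * \<tau>) \<le> B"
      unfolding z by (rule B[OF y l(2)])
    then show ?thesis
      by (simp only: petersson_lattice[OF \<tau> l(1)])
  qed
  \<comment> \<open>Here n bounds the number of inversions needed to reach height 3/4.\<close>
  have "Im \<tau> * (16 / 13) ^ n \<ge> 3 / 4 \<Longrightarrow> \<tau> \<in> uhp \<Longrightarrow> petersson \<tau> z1 z2 \<le> B" for n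
  proof (induction n arbitrary: \<tau> z1 z2)
    case 0
    then show ?case
      by (intro high) simp
  next
    case (Suc n)
    show ?case
    proof (cases "Im \<tau> \<ge> 3 / 4")
      case False
      define t where "t = \<tau> + of_int (- round (Re \<tau>))"
      have t: "t \<in> uhp" "Im t = Im \<tau>"
        using Suc.prems by (auto simp: t_def uhp_def)
      then have t0: "t \<noteq> 0"
        by (auto simp: uhp_def)
      have "\<bar>Re t\<bar> \<le> \<bar>1 / 2\<bar>" "\<bar>Im t\<bar> \<le> \<bar>3 / 4\<bar>"
        using of_int_round_abs_le[of "Re \<tau>"] False t by (auto simp: t_def uhp_def abs_minus_commute)
      then have "(Re t)\<^sup>2 \<le> (1 / 2)\<^sup>2" "(Im t)\<^sup>2 \<le> (3 / 4)\<^sup>2"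
        unfolding abs_le_square_iff .
      then have nt: "(norm t)\<^sup>2 \<le> 13 / 16"
        unfolding cmod_power2 by (simp add: power2_eq_square)
      have Im': "Im (- 1 / t) = Im t / (norm t)\<^sup>2"
        using t0 by (simp add: Im_divide cmod_power2)
      have "Im \<tau> * (16 / 13) \<le> Im (- 1 / t)"
        unfolding Im' t(2)[symmetric] using nt t(1) t0 by (simp add: field_simps uhp_def)
      then have "Im \<tau> * (16 / 13) * (16 / 13) ^ n \<le> Im (- 1 / t) * (16 / 13) ^ n"
        by (intro mult_right_mono) auto
      then have "3 / 4 \<le> Im (- 1 / t) * (16 / 13) ^ n"
        using Suc.prems(1) by (simp add: mult_ac)
      moreover have "- 1 / t \<in> uhp"
        using t(1) t0 unfolding uhp_def mem_Collect_eq Im' by simp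
      ultimately have "petersson (- 1 / t) (z1 / t) (z2 / t) \<le> B"
        by (rule Suc.IH)
      then show ?thesis
        unfolding petersson_invert[OF t(1)] unfolding t_def petersson_translate[OF Suc.prems(2)] .
    qed (rule high)
  qed
  moreover obtain n where "3 / 4 / Im \<tau> < (16 / 13) ^ n"
    using real_arch_pow[of "16 / 13"] by auto
  then have "3 / 4 \<le> Im \<tau> * (16 / 13) ^ n"
    using \<tau> by (simp add: field_simps uhp_def)
  ultimately show ?thesis
    using \<tau> by blast
qed

text \<open>The a priori bound that starts the iteration. Above height 3/4 the series of a slice is
  dominated by one convergent series, independent of l and u because |l| \<le> 1.\<close>

lemma petersson_bounded:
  obtains B where "B > 0" "\<And>\<tau> z1 z2. \<tau> \<in> uhp \<Longrightarrow> petersson \<tau> z1 z2 \<le> B"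
proof -
  \<comment> \<open>At height 3/4 the exponent n - 2|r| - 3k/16 contributes exp(2 \<pi> (3/2) |r|)
    and the constant C defined below. The summand 1 in B ensures positivity, which the maximum
    principle requires.\<close>
  define M where "M = (\<lambda>(n, r). norm (c (n, r)) * exp (- 2 * pi * real n * Im (\<i> * 3 / 4)) * exp (2 * pi * (3 / 2) * norm r))"
  have M: "M summable_on fourier_index m"
    unfolding M_def by (rule summable_exp_norm) (auto simp: uhp_def)
  define C where "C = exp (2 * pi * (3 * real k / 16) * (3 / 4))"
  define B where "B = C * infsum M (fourier_index m) + 1"
  have nonneg: "infsum M (fourier_index m) \<ge> 0"
    by (rule infsum_nonneg) (auto simp: M_def)
  have "petersson \<tau> (l * \<tau> + u) (cnj l * \<tau> + cnj u) \<le> B"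
    if y: "Im \<tau> \<ge> 3 / 4" and l: "(norm l)\<^sup>2 \<le> 1 / 2" for \<tau> l u
  proof -
    have \<tau>: "\<tau> \<in> uhp"
      using y by (simp add: uhp_def)
    have "norm (slice l u \<tau>) \<le> C * infsum M (fourier_index m)"
    proof (rule norm_infsum_le[OF slice_has_sum[OF \<tau>]])
      show "((\<lambda>p. C * M p) has_sum C * infsum M (fourier_index m)) (fourier_index m)"
        using M by (intro has_sum_cmult_right) simp
      fix p assume p: "p \<in> fourier_index m"
      obtain n r where nr: "p = (n, r)" by fastforce
      show "norm (slice_coeff u p * e (of_real (slice_exponent l p) * \<tau>)) \<le> C * M p"
      proof (cases "slice_coeff u p = 0")
        case False
        have "norm l \<le> 1"
          using l abs_le_square_iff[of "norm l" 1] by simp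
        then have "norm r * norm l \<le> norm r"
          by (simp add: mult_left_le)
        moreover have "- (norm r * norm l) \<le> Re (r * l)"
          using complex_Re_le_cmod[of "- (r * l)"] by (simp add: norm_mult)
        ultimately have "slice_exponent l p \<ge> real n - 2 * norm r - 3 * real k / 16"
          using mult_nonneg_nonneg[of "real m" "(norm l)\<^sup>2"] unfolding nr slice_exponent_def prod.case
          by (smt (verit) of_nat_0_le_iff zero_le_power2)
        then have "(real n - 2 * norm r - 3 * real k / 16) * (3 / 4) \<le> slice_exponent l p * (3 / 4)"
          by (intro mult_right_mono) auto
        also have "\<dots> \<le> slice_exponent l p * Im \<tau>"
          using slice_exponent_nonneg[OF l p False] y by (intro mult_left_mono)
        finally have "2 * pi * ((real n - 2 * norm r - 3 * real k / 16) * (3 / 4)) \<le> 2 * pi * (slice_exponent l p * Im \<tau>)"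
          by (intro mult_left_mono) auto
        then have "exp (- 2 * pi * Im (of_real (slice_exponent l p) * \<tau>)) \<le>
            exp (2 * pi * (3 * real k / 16) * (3 / 4) + - 2 * pi * real n * Im (\<i> * 3 / 4) + 2 * pi * (3 / 2) * norm r)"
          by (simp add: algebra_simps)
        moreover have "C * M p = norm (c p) *
            exp (2 * pi * (3 * real k / 16) * (3 / 4) + - 2 * pi * real n * Im (\<i> * 3 / 4) + 2 * pi * (3 / 2) * norm r)"
          unfolding nr M_def C_def prod.case exp_add by (simp only: mult_ac)
        ultimately show ?thesis
          unfolding norm_mult norm_slice_coeff norm_e by (simp only: mult_left_mono norm_ge_zero)
      qed (auto simp: nr M_def C_def)
    qed
    \<comment> \<open>With y = Im \<tau>, sqrt y \<le> 1 + y \<le> exp y, and 3 \<pi> / 8 >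
      1.\<close>
    moreover have "(sqrt (Im \<tau>) * exp (- 3 * pi / 8 * Im \<tau>)) ^ k \<le> 1"
    proof (rule power_le_one)
      have "sqrt (Im \<tau>) \<le> sqrt ((Im \<tau> + 1)\<^sup>2)"
        using y by (intro real_sqrt_le_mono) (simp add: power2_eq_square algebra_simps)
      also have "\<dots> = 1 + Im \<tau>"
        using y by simp
      also have "\<dots> \<le> exp (Im \<tau>)"
        by (rule exp_ge_add_one_self)
      also have "\<dots> \<le> exp (3 * pi / 8 * Im \<tau>)"
      proof -
        have "1 * Im \<tau> \<le> 3 * pi / 8 * Im \<tau>"
          using y pi_gt3 by (intro mult_right_mono) auto
        then show ?thesis by simp
      qed
      finally show "sqrt (Im \<tau>) * exp (- 3 * pi / 8 * Im \<tau>) \<le> 1"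
        by (simp add: exp_minus field_simps)
    qed (use y in auto)
    ultimately have "(sqrt (Im \<tau>) * exp (- 3 * pi / 8 * Im \<tau>)) ^ k * norm (slice l u \<tau>) \<le> 1 * (C * infsum M (fourier_index m))"
      using y by (intro mult_mono) auto
    then show ?thesis
      unfolding petersson_eq_slice[OF \<tau>] B_def by simp
  qed
  from petersson_le_by_reduction[of B, OF this] show thesis
    using nonneg by (intro that[of B]) (auto simp: B_def C_def intro!: add_nonneg_pos mult_nonneg_nonneg)
qed

text \<open>The bound on the horizontal line of height \<open>y / 2\<close> gains, by the maximum principle, the factor
  \<open>(sqrt 2 * exp (- 3 * pi * y / 16)) ^ k\<close> at height \<open>y\<close>.\<close>

lemma petersson_contraction:
  assumes B: "\<And>\<tau> z1 z2. \<tau> \<in> uhp \<Longrightarrow> petersson \<tau> z1 z2 \<le> B" and B0: "B > 0"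
    and \<tau>: "\<tau> \<in> uhp"
  shows "petersson \<tau> z1 z2 \<le> (sqrt 2 * exp (- 9 * pi / 64)) ^ k * B"
proof (rule petersson_le_by_reduction[OF _ \<tau>])
  fix w l u :: complex assume y: "Im w \<ge> 3 / 4" and l: "(norm l)\<^sup>2 \<le> 1 / 2"
  \<comment> \<open>This height may fall below 3/4; B is usable there because it bounds W on the
    whole upper half plane.\<close>
  define y0 where "y0 = Im w / 2"
  have y0: "y0 > 0" "y0 \<le> Im w"
    using y by (auto simp: y0_def)
  have w: "w \<in> uhp"
    using y by (simp add: uhp_def)
  define A where "A t = (sqrt t * exp (- 3 * pi / 8 * t)) ^ k" for t
  have A: "A t > 0" if "t > 0" for t
    using that by (simp add: A_def)
  have "norm (slice l u w) \<le> B / A y0"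
  proof (rule exponential_series_maximum_principle[OF slice_has_sum slice_exponent_nonneg[OF l] y0(1) _ _ y0(2)])
    fix t assume t: "Im t = y0"
    then have "t \<in> uhp"
      using y0 by (simp add: uhp_def)
    from B[OF this, of "l * t + u" "cnj l * t + cnj u"] show "norm (slice l u t) \<le> B / A y0"
      unfolding petersson_eq_slice[OF \<open>t \<in> uhp\<close>] t A_def[symmetric] using A[OF y0(1)] by (simp add: field_simps)
  qed (use A[OF y0(1)] B0 in auto)
  then have "A (Im w) * norm (slice l u w) \<le> A (Im w) * (B / A y0)"
    using y by (intro mult_left_mono) (auto simp: A_def)
  also have "\<dots> = (A (Im w) / A y0) * B"
    by simp
  also have "A (Im w) / A y0 = (sqrt 2 * exp (- 3 * pi / 16 * Im w)) ^ k"
  proof -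
    have "sqrt (Im w) = sqrt 2 * sqrt y0"
      unfolding real_sqrt_mult[symmetric] y0_def by simp
    moreover have "exp (- 3 * pi / 8 * Im w) = exp (- 3 * pi / 16 * Im w) * exp (- 3 * pi / 8 * y0)"
      unfolding exp_add[symmetric] y0_def by (simp add: field_simps)
    ultimately have "sqrt (Im w) * exp (- 3 * pi / 8 * Im w) =
        (sqrt 2 * exp (- 3 * pi / 16 * Im w)) * (sqrt y0 * exp (- 3 * pi / 8 * y0))"
      by simp
    then have "A (Im w) = (sqrt 2 * exp (- 3 * pi / 16 * Im w)) ^ k * A y0"
      unfolding A_def by (simp only: power_mult_distrib)
    then show ?thesis
      using A[OF y0(1)] by simp
  qed
  \<comment> \<open>At Im w \<ge> 3/4 the exponent is at most - (3 \<pi> / 16) (3 / 4) = - 9 \<pi> /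
    64.\<close>
  also have "\<dots> * B \<le> (sqrt 2 * exp (- 9 * pi / 64)) ^ k * B"
    using y B0 pi_gt_zero by (intro mult_right_mono power_mono mult_left_mono) (auto simp: field_simps)
  finally show "petersson w (l * w + u) (cnj l * w + cnj u) \<le> (sqrt 2 * exp (- 9 * pi / 64)) ^ k * B"
    unfolding petersson_eq_slice[OF w] A_def .
qed

text \<open>After squaring the claim is 2 < exp(9 \<pi> / 32); \<pi> > 3 and the quadratic Taylor
  polynomial at 27/32 suffice.\<close>

lemma sqrt2_exp_less_1: "sqrt 2 * exp (- 9 * pi / 64) < 1"
proof -
  have "sqrt 2 < exp (9 * pi / 64)"
  proof (rule real_less_lsqrt)
    have "2 < 1 + 27 / 32 + (27 / 32)\<^sup>2 / (2 :: real)"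
      by (simp add: power2_eq_square)
    also have "\<dots> \<le> exp (27 / 32)"
      by (rule exp_lower_Taylor_quadratic) simp
    also have "\<dots> \<le> exp (2 * (9 * pi / 64))"
      using pi_gt3 by simp
    also have "\<dots> = (exp (9 * pi / 64))\<^sup>2"
      unfolding exp_double[symmetric] by simp
    finally show "2 < (exp (9 * pi / 64))\<^sup>2" .
  qed auto
  then show ?thesis
    by (simp add: exp_minus field_simps)
qed

lemma vanishes:
  assumes \<tau>: "\<tau> \<in> uhp"
  shows "f \<tau> z1 z2 = 0"
proof -
  obtain B where B: "B > 0" "\<And>\<tau> z1 z2. \<tau> \<in> uhp \<Longrightarrow> petersson \<tau> z1 z2 \<le> B"
    using petersson_bounded by blast
  define \<rho> where "\<rho> = (sqrt 2 * exp (- 9 * pi / 64)) ^ k"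
  have \<rho>: "0 < \<rho>" "\<rho> < 1"
    using sqrt2_exp_less_1 k by (auto simp: \<rho>_def intro!: power_less_one_iff[THEN iffD2])
  \<comment> \<open>Quantified over all points, since one contraction step at a point uses the
    previous bound at other points.\<close>
  have bound: "petersson \<tau> z1 z2 \<le> \<rho> ^ n * B" if "\<tau> \<in> uhp" for n \<tau> z1 z2
    using that
  proof (induction n arbitrary: \<tau> z1 z2)
    case (Suc n)
    have "petersson \<tau> z1 z2 \<le> \<rho> * (\<rho> ^ n * B)"
      unfolding \<rho>_def by (rule petersson_contraction[OF Suc.IH[unfolded \<rho>_def] _ Suc.prems]) (use \<rho> B in \<open>auto simp: \<rho>_def\<close>)
    then show ?case
      by (simp add: mult_ac)
  qed (use B in auto)
  have "(\<lambda>n. \<rho> ^ n * B) \<longlonglongrightarrow> 0 * B"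
    using \<rho> by (intro tendsto_mult LIMSEQ_power_zero tendsto_const) auto
  then have "petersson \<tau> z1 z2 \<le> 0 * B"
    by (rule LIMSEQ_le_const) (use bound[OF \<tau>] in blast)
  moreover have "sqrt (Im \<tau>) ^ k * exp (- pi * real m * (norm (z1 - cnj z2))\<^sup>2 / (2 * Im \<tau>)) > 0"
    using \<tau> by (simp add: uhp_def)
  from mult_le_cancel_left_pos[OF this, of "norm (f \<tau> z1 z2)" 0] have "petersson \<tau> z1 z2 \<le> 0 \<longleftrightarrow> norm (f \<tau> z1 z2) \<le> 0"
    by (simp add: petersson_def)
  ultimately show ?thesis
    by simp
qed

end


text \<open>Injectivity is expressed by two forms with equal images. The conclusion is equality over
  \<open>uhp\<close>, since \<open>JSpez\<close> does not constrain the values of these total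
  functions at other \<tau>.\<close>

theorem theorem6p6:
  fixes k m :: nat
    and \<phi> \<psi> :: "complex \<Rightarrow> complex \<Rightarrow> complex \<Rightarrow> complex"
  assumes "k > 0" and "m > 0" and "k mod 4 = 0"
    and "\<phi> \<in> JSpez k m" and "\<psi> \<in> JSpez k m"
    and "\<forall>\<nu> \<le> Rfun m (4 * m * kappa k m). \<forall>\<tau>\<in>uhp. Dop k m \<nu> \<phi> \<tau> = Dop k m \<nu> \<psi> \<tau>"
  shows "\<forall>\<tau>\<in>uhp. \<forall>z1 z2. \<phi> \<tau> z1 z2 = \<psi> \<tau> z1 z2"
proof -
  \<comment> \<open>Both the estimate of \<kappa> and the lower bound 3k/16 for the exponents start
    at this weight.\<close>
  have k: "k \<ge> 4"
    using assms(1,3) by presburger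
  obtain c1 where "fourier_expansion m c1 \<phi>"
    and radial1: "\<And>n r n' r'. (n, r) \<in> fourier_index m \<Longrightarrow> (n', r') \<in> fourier_index m \<Longrightarrow>
      real n * real m - normK r = real n' * real m - normK r' \<Longrightarrow> c1 (n, r) = c1 (n', r')"
    using assms(4) unfolding JSpez_def fourier_expansion_def by blast
  obtain c2 where "fourier_expansion m c2 \<psi>"
    and radial2: "\<And>n r n' r'. (n, r) \<in> fourier_index m \<Longrightarrow> (n', r') \<in> fourier_index m \<Longrightarrow>
      real n * real m - normK r = real n' * real m - normK r' \<Longrightarrow> c2 (n, r) = c2 (n', r')"
    using assms(5) unfolding JSpez_def fourier_expansion_def by blast
  interpret F1: fourier_expansion m c1 \<phi> by fact
  interpret F2: fourier_expansion m c2 \<psi> by fact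
  define N where "N = Rfun m (4 * m * kappa k m)"
  have low: "c1 (n, r) = c2 (n, r)" if n: "n \<le> kappa k m" and r: "r \<in> dual_ball m n" for n r
  proof (rule diagonal_coeffs_determine_radial_coeffs[OF F1.fourier_expansion_axioms F2.fourier_expansion_axioms])
    show "F1.diagonal_coeff n j = F2.diagonal_coeff n j" if "j \<le> N" for j
      using diagonal_coeffs_eq[OF F1.fourier_expansion_axioms F2.fourier_expansion_axioms assms(1) _ that] assms(6)
      by (simp add: N_def)
    have "4 * n * m \<le> 4 * m * kappa k m"
      using n by simp
    also have "\<dots> \<le> N"
      unfolding N_def using assms(2) by (rule Rfun_ge)
    finally show "4 * n * m \<le> N" .
    fix r r' assume r: "r \<in> dual_ball m n" "r' \<in> dual_ball m n" "normK r = normK r'"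
    show "c1 (n, r) = c1 (n, r')" "c2 (n, r) = c2 (n, r')"
      using r by (auto intro!: radial1 radial2 simp: fourier_index_eq_Sigma)
  qed (rule r)
  have JK: "\<phi> \<in> JK k m" "\<psi> \<in> JK k m"
    using assms(4,5) by (auto simp: JSpez_def)
  have modular: "inverse ((of_int c * \<tau> + of_int d) ^ k)
          * e (- of_nat m * of_int c * z1 * z2 / (of_int c * \<tau> + of_int d))
          * F ((of_int a * \<tau> + of_int b) / (of_int c * \<tau> + of_int d))
               (z1 / (of_int c * \<tau> + of_int d)) (z2 / (of_int c * \<tau> + of_int d))
          = F \<tau> z1 z2"
    if "F \<in> JK k m" "a * d - b * c = 1" "\<tau> \<in> uhp" for F :: "complex \<Rightarrow> complex \<Rightarrow> complex \<Rightarrow> complex" and a b c d :: int and \<tau> z1 z2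
  proof -
    have "1 \<in> gauss_units"
      by (simp add: gauss_units_def)
    then show ?thesis
      using that unfolding JK_def by fastforce
  qed
  have translate: "F (\<tau> + of_int b) z1 z2 = F \<tau> z1 z2" if "F \<in> JK k m" "\<tau> \<in> uhp" for F b \<tau> z1 z2
    \<comment> \<open>The instantiation order is a, d, b, c: the matrix is the unipotent one with c
      = 0.\<close>
    using modular[OF that(1) _ that(2), of 1 1 b 0 z1 z2] by (simp add: e_def)
  have invert: "F (- 1 / \<tau>) (z1 / \<tau>) (z2 / \<tau>) = \<tau> ^ k * e (of_nat m * z1 * z2 / \<tau>) * F \<tau> z1 z2"
    if "F \<in> JK k m" "\<tau> \<in> uhp" for F \<tau> z1 z2
  proof -
    let ?e = "e (of_nat m * z1 * z2 / \<tau>)" and ?e' = "e (- of_nat m * z1 * z2 / \<tau>)"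
    have "\<tau> \<noteq> 0"
      using that(2) by (auto simp: uhp_def)
    moreover have "?e * ?e' = 1"
      unfolding e_add[symmetric] by (simp add: e_def)
    moreover have F: "F \<tau> z1 z2 = inverse (\<tau> ^ k) * ?e' * F (- 1 / \<tau>) (z1 / \<tau>) (z2 / \<tau>)"
      \<comment> \<open>The matrix with a = d = 0, b = -1, c = 1.\<close>
      using modular[OF that(1) _ that(2), of 0 0 "- 1" 1 z1 z2] by simp
    moreover have "\<tau> ^ k * ?e * F \<tau> z1 z2 =
        (\<tau> ^ k * inverse (\<tau> ^ k)) * (?e * ?e') * F (- 1 / \<tau>) (z1 / \<tau>) (z2 / \<tau>)"
      unfolding F by (simp only: mult_ac)
    ultimately show ?thesis
      by simp
  qed
  have lattice: "e (of_nat m * (of_real (normK l) * \<tau> + cnj l * z1 + l * z2)) *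
      F \<tau> (z1 + l * \<tau>) (z2 + cnj l * \<tau>) = F \<tau> z1 z2"
    if "F \<in> JK k m" "\<tau> \<in> uhp" "l \<in> gauss_ints" for F \<tau> l z1 z2
  proof -
    have "0 \<in> gauss_ints"
      unfolding gauss_ints_def by (auto intro!: exI[of _ 0])
    moreover have "\<forall>lam\<in>gauss_ints. \<forall>\<mu>\<in>gauss_ints. \<forall>\<tau>\<in>uhp. \<forall>z1 z2.
        e (of_nat m * (of_real (normK lam) * \<tau> + cnj lam * z1 + lam * z2))
        * F \<tau> (z1 + lam * \<tau> + \<mu>) (z2 + cnj lam * \<tau> + cnj \<mu>) = F \<tau> z1 z2"
      using that(1) unfolding JK_def by blast
    ultimately show ?thesis
      using that(2,3) by fastforce
  qed
  interpret jacobi_form_of_high_order m "\<lambda>p. c1 p - c2 p" "\<lambda>\<tau> z1 z2. \<phi> \<tau> z1 z2 - \<psi> \<tau> z1 z2" k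
  proof unfold_locales
    fix \<tau> z1 z2 :: complex assume \<tau>: "\<tau> \<in> uhp"
    have "((\<lambda>p. (case p of (n, r) \<Rightarrow> c1 (n, r) * e (of_nat n * \<tau> + r * z1 + cnj r * z2)) -
        (case p of (n, r) \<Rightarrow> c2 (n, r) * e (of_nat n * \<tau> + r * z1 + cnj r * z2))) has_sum \<phi> \<tau> z1 z2 - \<psi> \<tau> z1 z2) (fourier_index m)"
      using has_sum_add[OF F1.expansion[OF \<tau>, of z1 z2] has_sum_uminusI[OF F2.expansion[OF \<tau>, of z1 z2]]] by simp
    then show "((\<lambda>(n, r). (c1 (n, r) - c2 (n, r)) * e (of_nat n * \<tau> + r * z1 + cnj r * z2)) has_sum \<phi> \<tau> z1 z2 - \<psi> \<tau> z1 z2) (fourier_index m)"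
      by (simp add: case_prod_unfold left_diff_distrib)
    show "\<phi> (\<tau> + of_int b) z1 z2 - \<psi> (\<tau> + of_int b) z1 z2 = \<phi> \<tau> z1 z2 - \<psi> \<tau> z1 z2" for b
      using JK \<tau> by (simp add: translate)
    show "\<phi> (- 1 / \<tau>) (z1 / \<tau>) (z2 / \<tau>) - \<psi> (- 1 / \<tau>) (z1 / \<tau>) (z2 / \<tau>) =
        \<tau> ^ k * e (of_nat m * z1 * z2 / \<tau>) * (\<phi> \<tau> z1 z2 - \<psi> \<tau> z1 z2)"
      unfolding invert[OF JK(1) \<tau>] invert[OF JK(2) \<tau>] by (simp add: right_diff_distrib)
    show "e (of_nat m * (of_real (normK l) * \<tau> + cnj l * z1 + l * z2)) *
        (\<phi> \<tau> (z1 + l * \<tau>) (z2 + cnj l * \<tau>) - \<psi> \<tau> (z1 + l * \<tau>) (z2 + cnj l * \<tau>)) = \<phi> \<tau> z1 z2 - \<psi> \<tau> z1 z2"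
      if "l \<in> gauss_ints" for l
      unfolding right_diff_distrib using lattice[OF JK(1) \<tau> that] lattice[OF JK(2) \<tau> that] by simp
  next
    fix n r assume nr: "(n, r) \<in> fourier_index m" "c1 (n, r) - c2 (n, r) \<noteq> 0"
    then have "\<not> n \<le> kappa k m"
      using low[of n r] by (auto simp: fourier_index_eq_Sigma)
    \<comment> \<open>Integrality of n gains the 1 that was lost to the integer part in
      \<open>kappa\<close>.\<close>
    then have "real n \<ge> real (kappa k m) + 1"
      by simp
    then show "(real m)\<^sup>2 * real k / 2 + real m / 2 \<le> real n"
      using kappa_lower_bound[OF k, of m] by linarith
  qed (use k assms(2) in auto)
  show ?thesis
    using vanishes by auto
qed

end
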